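(* Let $g,n\ge0$ be integers with $2g-2+n>0$, let $\Gamma\in G_{g,n}$, and let $Q\in\mathbb Z[x_h: h\in H\setminus L]$ be a polynomial. Then the function $$\{A\in\mathbb Z^n:\textstyle\sum_i a_i=0\}\to\mathbb Q,\qquad A\mapsto S^\Gamma_{A,0}(Q)$$ is polynomial in $A$, i.e. there is a polynomial in $\mathbb Q[y_1,\dots,y_n]$ whose value at $A$ is $S^\Gamma_{A,0}(Q)$ for every $A\in\mathbb Z^n$ with $\sum_i a_i=0$.
   Context: **Graphs.** $G_{g,n}$ is the set of tuples $\Gamma=(V,H,L=(\ell_i)_{i=1}^n,r:H\to V,i:H\to H,g:V\to\mathbb Z_{\ge0})$ where $V$ is the (finite) set of vertices, $H$ the (finite) set of half-edges, $i$ an involution on $H$, $r$ assigns to each half-edge its incident vertex, $L$ is a list of the legs, which are exactly the fixed points of $i$, the graph $(V,H)$ is connected, $2g(v)-2+n(v)>0$ for each vertex $v$ (where $n(v)$ is the number of half-edges incident to $v$), and $\sum_{v}g(v)+h_1(\Gamma)=g$. The edges are the pairs $\{h,h'\}$ with $h'=i(h)\ne h$; $h_1(\Gamma)$ is the first Betti number, $\#E-\#V+1$. **Weightings.** Let $A\in\mathbb Z^n$ with $\sum a_i=0$. For an integer $r\ge1$, $W^\Gamma_{A,r}$ is the finite set of maps $w:H\to\{0,\dots,r-1\}$ such that: $w(\ell_j)\equiv a_j \pmod r$ for $j=1,\dots,n$; $w(h)+w(i(h))\equiv0\pmod r$ for $h\in H\setminus L$; and $\sum_{h:\,r(h)=v}w(h)\equiv0\pmod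 r$ for each vertex $v$. **Sums.** For $Q\in\mathbb Z[x_h:h\in H\setminus L]$ put $$S^\Gamma_{A,r}(Q)=r^{-h_1(\Gamma)}\sum_{w\in W^\Gamma_{A,r}}Q(w),$$ where $Q(w)$ is $Q$ evaluated at $x_h=w(h)$ (with $w(h)$ regarded as an integer in $\{0,\dots,r-1\}$). It is a known fact that for fixed $\Gamma,A,Q$ there is a polynomial in $r$ with rational coefficients that equals $S^\Gamma_{A,r}(Q)$ for all sufficiently large $r$; $S^\Gamma_{A,0}(Q)\in\mathbb Q$ denotes the constant term of this polynomial. *)

theory Defs
  imports
    "HOL-Library.Poly_Mapping"
    "HOL-Library.FuncSet"
    "HOL-Number_Theory.Cong"
    "HOL-Computational_Algebra.Polynomial"
begin

text \<open>Multivariate polynomials with variables of type \<open>'x\<close> and coefficients of type \<open>'a\<close>: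
  finitely supported maps from monomials to coefficients, a monomial being a finitely supported
  map from variables to exponents.\<close>

type_synonym ('x, 'a) mpoly = "('x \<Rightarrow>\<^sub>0 nat) \<Rightarrow>\<^sub>0 'a"

definition mpoly_vars :: "('x, 'a::zero) mpoly \<Rightarrow> 'x set" where
  "mpoly_vars P = (\<Union>m\<in>Poly_Mapping.keys P. Poly_Mapping.keys m)"

definition mpoly_eval :: "('x, 'a::comm_semiring_1) mpoly \<Rightarrow> ('x \<Rightarrow> 'a) \<Rightarrow> 'a" where
  "mpoly_eval P x =
     (\<Sum>m\<in>Poly_Mapping.keys P. Poly_Mapping.lookup P m *
        (\<Prod>k\<in>Poly_Mapping.keys m. x k ^ Poly_Mapping.lookup m k))"

record ('v, 'h) leg_graph =
  verts :: "'v set"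
  halfedges :: "'h set"
  legs :: "'h list"
  root :: "'h \<Rightarrow> 'v"
  invol :: "'h \<Rightarrow> 'h"
  genus :: "'v \<Rightarrow> nat"

definition edges :: "('v, 'h) leg_graph \<Rightarrow> 'h set set" where
  "edges \<Gamma> = {{h, invol \<Gamma> h} | h. h \<in> halfedges \<Gamma> \<and> invol \<Gamma> h \<noteq> h}"

definition valence :: "('v, 'h) leg_graph \<Rightarrow> 'v \<Rightarrow> nat" where
  "valence \<Gamma> v = card {h \<in> halfedges \<Gamma>. root \<Gamma> h = v}"

definition betti :: "('v, 'h) leg_graph \<Rightarrow> int" where
  "betti \<Gamma> = int (card (edges \<Gamma>)) - int (card (verts \<Gamma>)) + 1"

definition connected_graph :: "('v, 'h) leg_graph \<Rightarrow> bool" where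
  "connected_graph \<Gamma> \<longleftrightarrow> verts \<Gamma> \<noteq> {} \<and>
     (\<forall>u\<in>verts \<Gamma>. \<forall>v\<in>verts \<Gamma>.
        (u, v) \<in> {(root \<Gamma> h, root \<Gamma> (invol \<Gamma> h)) | h. h \<in> halfedges \<Gamma>}\<^sup>*)"

definition stable_graphs :: "nat \<Rightarrow> nat \<Rightarrow> ('v, 'h) leg_graph set" where
  "stable_graphs g n = {\<Gamma>.
     finite (verts \<Gamma>) \<and> finite (halfedges \<Gamma>) \<and>
     root \<Gamma> \<in> halfedges \<Gamma> \<rightarrow> verts \<Gamma> \<and>
     invol \<Gamma> \<in> halfedges \<Gamma> \<rightarrow> halfedges \<Gamma> \<and>
     (\<forall>h\<in>halfedges \<Gamma>. invol \<Gamma> (invol \<Gamma> h) = h) \<and>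
     length (legs \<Gamma>) = n \<and> distinct (legs \<Gamma>) \<and>
     set (legs \<Gamma>) = {h \<in> halfedges \<Gamma>. invol \<Gamma> h = h} \<and>
     connected_graph \<Gamma> \<and>
     (\<forall>v\<in>verts \<Gamma>. 2 * int (genus \<Gamma> v) - 2 + int (valence \<Gamma> v) > 0) \<and>
     (\<Sum>v\<in>verts \<Gamma>. int (genus \<Gamma> v)) + betti \<Gamma> = int g}"

text \<open>Maps on the half-edges are taken extensional (\<open>undefined\<close> elsewhere), so that each
  weighting is counted once. A vector in \<open>\<int>\<^sup>n\<close> is an integer list of length \<open>n\<close>, so
  leg \<open>\<ell>\<^sub>j\<close> and entry \<open>a\<^sub>j\<close> are at position \<open>j - 1\<close>.\<close>

definition weightings :: "('v, 'h) leg_graph \<Rightarrow> int list \<Rightarrow> nat \<Rightarrow> ('h \<Rightarrow> int) set" where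
  "weightings \<Gamma> A r = {w \<in> halfedges \<Gamma> \<rightarrow>\<^sub>E {0..<int r}.
     (\<forall>j<length (legs \<Gamma>). [w (legs \<Gamma> ! j) = A ! j] (mod int r)) \<and>
     (\<forall>h \<in> halfedges \<Gamma> - set (legs \<Gamma>). [w h + w (invol \<Gamma> h) = 0] (mod int r)) \<and>
     (\<forall>v \<in> verts \<Gamma>. [(\<Sum>h | h \<in> halfedges \<Gamma> \<and> root \<Gamma> h = v. w h) = 0] (mod int r))}"

definition weighting_sum ::
  "('v, 'h) leg_graph \<Rightarrow> ('h, int) mpoly \<Rightarrow> int list \<Rightarrow> nat \<Rightarrow> rat" where
  "weighting_sum \<Gamma> Q A r =
     of_nat r powi (- betti \<Gamma>) * (\<Sum>w\<in>weightings \<Gamma> A r. of_int (mpoly_eval Q w))"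

text \<open>The constant term of the polynomial in \<open>r\<close> that agrees with \<open>weighting_sum \<Gamma> Q A r\<close> for
  all large \<open>r\<close>. There is at most one such polynomial, so the description picks out the intended
  one as soon as it exists; see \<open>weighting_sum_0_eqI\<close>.\<close>

definition weighting_sum_0 ::
  "('v, 'h) leg_graph \<Rightarrow> ('h, int) mpoly \<Rightarrow> int list \<Rightarrow> rat" where
  "weighting_sum_0 \<Gamma> Q A =
     coeff (THE p :: rat poly.
       \<forall>\<^sub>F r in sequentially. weighting_sum \<Gamma> Q A r = poly p (of_nat r)) 0"

lemma poly_eqI_eventually:
  fixes p q :: "rat poly"
  assumes "\<forall>\<^sub>F r in sequentially. poly p (of_nat r) = poly q (of_nat r)"
  shows "p = q"
proof (rule ccontr)
  assume "p \<noteq> q"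
  then have fin: "finite {x. poly (p - q) x = 0}"
    by (intro poly_roots_finite) simp
  from assms obtain N where N: "\<And>r. r \<ge> N \<Longrightarrow> poly p (of_nat r) = poly q (of_nat r)"
    by (auto simp: eventually_sequentially)
  have "(of_nat :: nat \<Rightarrow> rat) ` {N..} \<subseteq> {x. poly (p - q) x = 0}"
    using N by auto
  then have "finite ((of_nat :: nat \<Rightarrow> rat) ` {N..})"
    using fin finite_subset by blast
  then have "finite {N..}"
    by (rule finite_imageD) (simp add: inj_on_def)
  then show False
    by (simp add: infinite_Ici)
qed

lemma weighting_sum_0_eqI:
  assumes "\<forall>\<^sub>F r in sequentially. weighting_sum \<Gamma> Q A r = poly p (of_nat r)"
  shows "weighting_sum_0 \<Gamma> Q A = coeff p 0"
proof -
  have "(THE p :: rat poly.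
      \<forall>\<^sub>F r in sequentially. weighting_sum \<Gamma> Q A r = poly p (of_nat r)) = p"
  proof (rule the_equality)
    show "\<forall>\<^sub>F r in sequentially. weighting_sum \<Gamma> Q A r = poly p (of_nat r)"
      by (fact assms)
  next
    fix q :: "rat poly"
    assume "\<forall>\<^sub>F r in sequentially. weighting_sum \<Gamma> Q A r = poly q (of_nat r)"
    with assms show "q = p"
      by (intro poly_eqI_eventually) (auto elim: eventually_elim2)
  qed
  then show ?thesis
    by (simp add: weighting_sum_0_def)
qed

end

theory Submission
  imports Defs Complex_Main
begin

text \<open>
  Orient the edges of \<open>\<Gamma>\<close>, one half-edge for each edge; a weighting becomes a flow modulo \<open>r\<close>
  on a directed multigraph \<open>E\<close> with prescribed net inflow \<open>b\<close>. Let \<open>T b q\<close> be the sum, over these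
  flows \<open>x\<close>, of \<open>\<Prod>e. q e (x e)\<close>. Sending \<open>x e\<close> to \<open>x e + 1 mod r\<close> gives
  \<open>T (b + \<partial>e) q = T b q + T b (q with q e replaced by its difference) - (q e r - q e 0) * T' (b + \<partial>e) q\<close>,
  where \<open>T'\<close> refers to \<open>E - {e}\<close>. Divide by \<open>r\<close> to the power \<open>h\<^sub>1\<close>. If \<open>e\<close> is not a bridge, deleting it
  lowers \<open>h\<^sub>1\<close> by one, and the factor \<open>q e r - q e 0\<close>, divisible by \<open>r\<close>, makes up for this. If \<open>e\<close> is
  a bridge, the correction contributes nothing to the constant term. By induction on the number of
  edges and the degrees of \<open>q\<close>, all differences of the constant term as a function of \<open>b\<close> are
  polynomial, hence so is the constant term, provided that \<open>T 0 q\<close> is \<open>r\<close> to the power \<open>h\<^sub>1\<close> times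
  a polynomial in \<open>r\<close>.

  For the latter, Fourier inversion over the vertices turns \<open>T 0 q\<close> into a sum over families \<open>\<zeta>\<close> of
  \<open>r\<close>-th roots of unity of polynomials in \<open>r\<close>, in the indicators of \<open>\<zeta> u = \<zeta> v\<close> and in
  \<open>1 / (1 - \<zeta> u / \<zeta> v)\<close>. Partial fractions in one \<open>\<zeta> v\<close> allow to sum over it within the same class of
  functions, so that the vertices can be eliminated one by one.
\<close>

section \<open>Polynomial functions on integer lattices\<close>

text \<open>Polynomial functions are given by closure rules, which suit inductions and substitutions
  better than coefficients do; \<open>polyfun_imp_mpoly\<close> recovers a formal
  polynomial.\<close>

inductive_set polyfun :: "'i set \<Rightarrow> (('i \<Rightarrow> int) \<Rightarrow> rat) set" for I where
  polyfun_const: "(\<lambda>x. c) \<in> polyfun I"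
| polyfun_var: "i \<in> I \<Longrightarrow> (\<lambda>x. of_int (x i)) \<in> polyfun I"
| polyfun_add: "f \<in> polyfun I \<Longrightarrow> g \<in> polyfun I \<Longrightarrow> (\<lambda>x. f x + g x) \<in> polyfun I"
| polyfun_mult: "f \<in> polyfun I \<Longrightarrow> g \<in> polyfun I \<Longrightarrow> (\<lambda>x. f x * g x) \<in> polyfun I"

lemma polyfun_diff:
  assumes "f \<in> polyfun I" "g \<in> polyfun I"
  shows "(\<lambda>x. f x - g x) \<in> polyfun I"
  using polyfun_add[OF assms(1) polyfun_mult[OF polyfun_const[of "-1"] assms(2)]] by simp

lemma polyfun_sum:
  assumes "\<And>a. a \<in> S \<Longrightarrow> f a \<in> polyfun I"
  shows "(\<lambda>x. \<Sum>a\<in>S. f a x) \<in> polyfun I"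
  using assms
  by (induction S rule: infinite_finite_induct) (auto intro: polyfun_const polyfun_add)

lemma polyfun_poly:
  assumes "f \<in> polyfun I"
  shows "(\<lambda>x. poly p (f x)) \<in> polyfun I"
  using assms by (induction p) (auto intro: polyfun_const polyfun_add polyfun_mult)

lemma polyfun_subst:
  assumes "f \<in> polyfun I" and "\<And>i. i \<in> I \<Longrightarrow> (\<lambda>y. of_int (\<sigma> y i)) \<in> polyfun J"
  shows "(\<lambda>y. f (\<sigma> y)) \<in> polyfun J"
  using assms(1) by induction (auto intro: polyfun.intros assms(2))

lemma polyfun_mono: "f \<in> polyfun I \<Longrightarrow> I \<subseteq> J \<Longrightarrow> f \<in> polyfun J"
  by (drule polyfun_subst[where \<sigma> = "\<lambda>y. y" and J = J]) (auto intro: polyfun_var)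

lemma polyfun_cong:
  assumes "f \<in> polyfun I" and "\<And>i. i \<in> I \<Longrightarrow> x i = y i"
  shows "f x = f y"
  using assms(1) by induction (auto simp: assms(2))

section \<open>Antidifferences and discrete integration\<close>

lemma power_antidifference:
  "\<exists>q :: rat poly. \<forall>x. poly q (x + 1) - poly q x = x ^ k"
proof (induction k rule: less_induct)
  case (less k)
  then have "\<forall>i\<in>{..<k}. \<exists>q :: rat poly. \<forall>x. poly q (x + 1) - poly q x = x ^ i"
    by blast
  then obtain q :: "nat \<Rightarrow> rat poly"
    where q: "\<And>i x. i < k \<Longrightarrow> poly (q i) (x + 1) - poly (q i) x = x ^ i"
    by (metis lessThan_iff)
  \<comment> \<open>The difference of \<open>x ^ Suc k\<close> is \<open>Suc k * x ^ k\<close> plus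
    lower powers, whose antidifferences \<open>q i\<close> come from the induction.\<close>
  define p where "p = smult (1 / of_nat (Suc k))
    (monom 1 (Suc k) - (\<Sum>i<k. smult (of_nat (Suc k choose i)) (q i)))"
  have "poly p (x + 1) - poly p x = x ^ k" for x
  proof -
    have "(x + 1) ^ Suc k = (\<Sum>i\<le>Suc k. of_nat (Suc k choose i) * x ^ i)"
      by (subst binomial_ring) simp
    also have "\<dots> = x ^ Suc k + of_nat (Suc k) * x ^ k + (\<Sum>i<k. of_nat (Suc k choose i) * x ^ i)"
      by (simp add: lessThan_Suc_atMost[symmetric] algebra_simps del: power_Suc)
    also have "(\<Sum>i<k. of_nat (Suc k choose i) * x ^ i) =
        (\<Sum>i<k. of_nat (Suc k choose i) * poly (q i) (x + 1)) -
        (\<Sum>i<k. of_nat (Suc k choose i) * poly (q i) x)"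
      by (simp add: sum_subtractf[symmetric] right_diff_distrib[symmetric] q)
    finally have "of_nat (Suc k) * (poly p (x + 1) - poly p x) = of_nat (Suc k) * x ^ k"
      by (simp add: p_def poly_monom poly_sum right_diff_distrib del: power_Suc)
    then show ?thesis
      by (simp del: of_nat_Suc)
  qed
  then show ?case by blast
qed

text \<open>Expansion by powers of \<open>x e\<close> with coefficients in the variables of
  \<open>I\<close>. An antidifference in direction \<open>e\<close> can then be taken term by
  term.\<close>

inductive_set var_expansion :: "'i \<Rightarrow> 'i set \<Rightarrow> (('i \<Rightarrow> int) \<Rightarrow> rat) set" for e I where
  single_var: "g \<in> polyfun I \<Longrightarrow> (\<lambda>x. g x * of_int (x e) ^ k) \<in> var_expansion e I"
| add: "f \<in> var_expansion e I \<Longrightarrow> g \<in> var_expansion e I \<Longrightarrow>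
    (\<lambda>x. f x + g x) \<in> var_expansion e I"

lemma var_expansion_mult_term:
  assumes "f \<in> var_expansion e I" and "g \<in> polyfun I"
  shows "(\<lambda>x. f x * (g x * of_int (x e) ^ k)) \<in> var_expansion e I"
  using assms(1)
proof induction
  case (single_var f j)
  show ?case
    using var_expansion.single_var[OF polyfun_mult[OF single_var assms(2)], of e "j + k"]
    by (simp add: power_add algebra_simps)
next
  case (add f1 f2)
  show ?case
    using var_expansion.add[OF add.IH] by (simp add: algebra_simps)
qed

lemma var_expansion_mult:
  assumes "f \<in> var_expansion e I" and "g \<in> var_expansion e I"
  shows "(\<lambda>x. f x * g x) \<in> var_expansion e I"
  using assms(2)
proof induction
  case (single_var g k)
  then show ?case by (rule var_expansion_mult_term[OF assms(1)])
next
  case (add g1 g2)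
  show ?case
    using var_expansion.add[OF add.IH] by (simp add: algebra_simps)
qed

lemma polyfun_imp_var_expansion:
  assumes "f \<in> polyfun (insert e I)"
  shows "f \<in> var_expansion e I"
  using assms
proof induction
  case (polyfun_const c)
  show ?case
    using var_expansion.single_var[OF polyfun.polyfun_const[of c I], of e 0] by simp
next
  case (polyfun_var i)
  then show ?case
    using var_expansion.single_var[OF polyfun.polyfun_const[of 1 I], of e 1]
      var_expansion.single_var[OF polyfun.polyfun_var[of i I], of e 0]
    by (cases "i = e") auto
qed (auto intro: var_expansion.add var_expansion_mult)

lemma polyfun_antidifference:
  assumes "f \<in> polyfun (insert e I)" and "e \<notin> I"
  shows "\<exists>R\<in>polyfun (insert e I). \<forall>x. R (x(e := x e + 1)) - R x = f x"
  using polyfun_imp_var_expansion[OF assms(1)]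
proof induction
  case (single_var g k)
  obtain q :: "rat poly" where q: "\<And>x. poly q (x + 1) - poly q x = x ^ k"
    using power_antidifference by blast
  let ?R = "\<lambda>x. g x * poly q (of_int (x e))"
  \<comment> \<open>As \<open>e\<close> lies outside \<open>I\<close>, the coefficient is constant
    in direction \<open>e\<close> and only the power of \<open>x e\<close> changes.\<close>
  have "g (x(e := y)) = g x" for x y
    by (rule polyfun_cong[OF single_var]) (use assms(2) in auto)
  then have "?R (x(e := x e + 1)) - ?R x = g x * of_int (x e) ^ k" for x
    by (simp add: q[symmetric] algebra_simps)
  moreover have "?R \<in> polyfun (insert e I)"
    by (intro polyfun_mult polyfun_poly polyfun_var polyfun_mono[OF single_var]) auto
  ultimately show ?case by (intro bexI[of _ ?R] allI)
next
  case (add f g)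
  then obtain R S where "R \<in> polyfun (insert e I)" "S \<in> polyfun (insert e I)"
    and "\<And>x. R (x(e := x e + 1)) - R x = f x" "\<And>x. S (x(e := x e + 1)) - S x = g x"
    by blast
  then show ?case
    by (intro bexI[of _ "\<lambda>x. R x + S x"] allI)
      (metis add_diff_add, rule polyfun_add)
qed

lemma int_step_invariant:
  fixes P :: "int \<Rightarrow> bool"
  assumes "P 0" and "\<And>k. P k \<longleftrightarrow> P (k + 1)"
  shows "P k"
proof (induction k rule: int_induct[where k = 0])
  case (step2 i)
  then show ?case using assms(2)[of "i - 1"] by simp
qed (use assms in auto)

text \<open>An antidifference \<open>R\<close> of the difference in one direction \<open>e\<close>
  leaves a remainder \<open>G - R\<close> that no longer depends on \<open>x e\<close>; the other
  directions follow by induction.\<close>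

lemma polyfun_discrete_integral:
  assumes "finite I"
    and "\<And>x y. (\<And>i. i \<in> I \<Longrightarrow> x i = y i) \<Longrightarrow> G x = G y"
    and "\<And>e. e \<in> I \<Longrightarrow> (\<lambda>x. G (x(e := x e + 1)) - G x) \<in> polyfun I"
  shows "G \<in> polyfun I"
  using assms
proof (induction I arbitrary: G rule: finite_induct)
  case empty
  then have "G = (\<lambda>x. G (\<lambda>_. 0))" by blast
  then show ?case using polyfun_const by metis
next
  case (insert e I)
  obtain R where R: "R \<in> polyfun (insert e I)"
    and Rd: "\<And>x. R (x(e := x e + 1)) - R x = G (x(e := x e + 1)) - G x"
    using polyfun_antidifference[OF insert.prems(2)[of e] insert.hyps(2)] by blast
  define H where "H x = G x - R x" for x
  have step: "H (x(e := k)) = H (x(e := k + 1))" for x k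
    using Rd[of "x(e := k)"] by (simp add: H_def)
  have zero: "H (x(e := k)) = H (x(e := 0))" for x k
    using int_step_invariant[of "\<lambda>k. H (x(e := k)) = H (x(e := 0))" k] step by simp
  have Hdep: "H x = H y" if "\<And>i. i \<in> insert e I \<Longrightarrow> x i = y i" for x y
    unfolding H_def
    using insert.prems(1)[of x y] polyfun_cong[OF R, of x y] that by auto
  have "H \<in> polyfun I"
  proof (rule insert.IH)
    fix x y :: "'a \<Rightarrow> int"
    assume xy: "\<And>i. i \<in> I \<Longrightarrow> x i = y i"
    have "H (x(e := 0)) = H (y(e := 0))"
      by (rule Hdep) (use xy in auto)
    then show "H x = H y"
      using zero[of x "x e"] zero[of y "y e"] by simp
  next
    fix f assume f: "f \<in> I"
    then have fe: "f \<noteq> e" using insert.hyps by auto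
    have "(\<lambda>x. R (x(f := x f + 1))) \<in> polyfun (insert e I)"
    proof (rule polyfun_subst[OF R])
      fix i assume "i \<in> insert e I"
      moreover have "(\<lambda>y :: 'a \<Rightarrow> int. rat_of_int (y f) + 1) \<in> polyfun (insert e I)"
        using f by (intro polyfun_add polyfun_const polyfun_var) auto
      ultimately show "(\<lambda>y. rat_of_int ((y(f := y f + 1)) i)) \<in> polyfun (insert e I)"
        by (cases "i = f") (auto intro: polyfun_var)
    qed
    then have "(\<lambda>x. (G (x(f := x f + 1)) - G x) - (R (x(f := x f + 1)) - R x))
        \<in> polyfun (insert e I)"
      using f R by (intro polyfun_diff insert.prems) auto
    then have *: "(\<lambda>x. H (x(f := x f + 1)) - H x) \<in> polyfun (insert e I)"
      by (simp add: H_def algebra_simps)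
    \<comment> \<open>Restriction to \<open>x e = 0\<close> removes the variable \<open>e\<close>
      from this difference, without loss since \<open>H\<close> is constant in direction
      \<open>e\<close>.\<close>
    have "(\<lambda>x. H ((x(e := 0))(f := (x(e := 0)) f + 1)) - H (x(e := 0))) \<in> polyfun I"
    proof (rule polyfun_subst[OF *, of "\<lambda>x. x(e := 0)" I])
      show "(\<lambda>y. rat_of_int ((y(e := 0)) i)) \<in> polyfun I" if "i \<in> insert e I" for i
        using that by (cases "i = e") (auto intro: polyfun_var polyfun_const)
    qed
    then have "(\<lambda>x. H ((x(e := 0))(f := x f + 1)) - H (x(e := 0))) \<in> polyfun I"
      by (simp only: fun_upd_other[OF fe])
    moreover have "H ((x(e := 0))(f := x f + 1)) = H (x(f := x f + 1))" for x
      using zero[of "x(f := x f + 1)" "x e"] fe by (simp add: fun_upd_twist)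
    moreover have "H (x(e := 0)) = H x" for x
      using zero[of x "x e"] by simp
    ultimately show "(\<lambda>x. H (x(f := x f + 1)) - H x) \<in> polyfun I"
      by simp
  qed
  then have "(\<lambda>x. H x + R x) \<in> polyfun (insert e I)"
    by (intro polyfun_add R) (auto elim: polyfun_mono)
  then show ?case by (simp add: H_def)
qed

text \<open>Only finitely many coordinates matter, so unit steps in both directions connect the
  relevant part of any \<open>x\<close> to the origin. This carries existence statements from demand
  zero to every demand.\<close>

lemma lattice_step_invariant:
  fixes P :: "('i \<Rightarrow> int) \<Rightarrow> bool"
  assumes "finite I"
    and "\<And>x y. (\<And>i. i \<in> I \<Longrightarrow> x i = y i) \<Longrightarrow> P x \<longleftrightarrow> P y"
    and "\<And>e x. e \<in> I \<Longrightarrow> P x \<longleftrightarrow> P (x(e := x e + 1))"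
    and "P (\<lambda>_. 0)"
  shows "P x"
  using assms
proof (induction I arbitrary: P x rule: finite_induct)
  case empty
  then show ?case by blast
next
  case (insert e I)
  have *: "P (x(e := 0))" for x
  proof (rule insert.IH[of "\<lambda>x. P (x(e := 0))"])
    show "P (x(e := 0)) \<longleftrightarrow> P (y(e := 0))" if "\<And>i. i \<in> I \<Longrightarrow> x i = y i" for x y :: "'i \<Rightarrow> int"
      by (rule insert.prems(1)) (use that in auto)
    show "P (x(e := 0)) \<longleftrightarrow> P ((x(f := x f + 1))(e := 0))" if "f \<in> I" for f x
    proof -
      have fe: "f \<noteq> e" using that insert.hyps(2) by blast
      have "P (x(e := 0)) \<longleftrightarrow> P ((x(e := 0))(f := (x(e := 0)) f + 1))"
        by (rule insert.prems(2)) (use that in simp)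
      then show ?thesis
        by (simp only: fun_upd_twist[OF fe] fun_upd_other[OF fe])
    qed
    have "(\<lambda>_. 0 :: int)(e := 0) = (\<lambda>_. 0)" by auto
    with insert.prems(3) show "P ((\<lambda>_. 0)(e := 0))" by simp
  qed
  have "P (x(e := k)) \<longleftrightarrow> P (x(e := k + 1))" for k
  proof -
    have "P (x(e := k)) \<longleftrightarrow> P ((x(e := k))(e := (x(e := k)) e + 1))"
      by (rule insert.prems(2)) simp
    then show ?thesis by (simp only: fun_upd_upd fun_upd_same)
  qed
  then have "P (x(e := x e))"
    by (rule int_step_invariant[of "\<lambda>k. P (x(e := k))", OF *])
  then show ?case by simp
qed

section \<open>From polynomial functions to formal polynomials\<close>

lemma mpoly_eval_eq_sum:
  assumes "finite K" and "Poly_Mapping.keys P \<subseteq> K"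
  shows "mpoly_eval P x = (\<Sum>m\<in>K. Poly_Mapping.lookup P m *
     (\<Prod>k\<in>Poly_Mapping.keys m. x k ^ Poly_Mapping.lookup m k))"
  unfolding mpoly_eval_def
  by (rule sum.mono_neutral_left[OF assms]) (auto simp: in_keys_iff)

lemma mpoly_eval_add: "mpoly_eval (P + Q) x = mpoly_eval P x + mpoly_eval Q x"
proof -
  let ?K = "Poly_Mapping.keys P \<union> Poly_Mapping.keys Q"
  have "Poly_Mapping.keys (P + Q) \<subseteq> ?K"
    by (rule Poly_Mapping.keys_add)
  then show ?thesis
    by (simp add: mpoly_eval_eq_sum[of ?K] lookup_add distrib_right sum.distrib)
qed

lemma mpoly_vars_add: "mpoly_vars (P + Q) \<subseteq> mpoly_vars P \<union> mpoly_vars Q"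
  using Poly_Mapping.keys_add[of P Q] unfolding mpoly_vars_def by blast

text \<open>Products are already multiplied out here, so only single monomials and sums have to be
  turned into \<open>mpoly\<close>; the same monomial may occur in several terms.\<close>

inductive_set monomial_sums :: "'i set \<Rightarrow> (('i \<Rightarrow> int) \<Rightarrow> rat) set" for I where
  monomial: "Poly_Mapping.keys m \<subseteq> I \<Longrightarrow>
    (\<lambda>x. c * (\<Prod>k\<in>Poly_Mapping.keys m. of_int (x k) ^ Poly_Mapping.lookup m k)) \<in> monomial_sums I"
| add: "f \<in> monomial_sums I \<Longrightarrow> g \<in> monomial_sums I \<Longrightarrow> (\<lambda>x. f x + g x) \<in> monomial_sums I"

lemma monomial_add:
  fixes x :: "'i \<Rightarrow> 'a :: comm_semiring_1"
  shows "(\<Prod>k\<in>Poly_Mapping.keys (m + m'). x k ^ Poly_Mapping.lookup (m + m') k) =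
    (\<Prod>k\<in>Poly_Mapping.keys m. x k ^ Poly_Mapping.lookup m k) *
    (\<Prod>k\<in>Poly_Mapping.keys m'. x k ^ Poly_Mapping.lookup m' k)"
proof -
  \<comment> \<open>Over the common support, missing variables enter with exponent 0, hence as
    factors 1.\<close>
  let ?K = "Poly_Mapping.keys m \<union> Poly_Mapping.keys m'"
  have ext: "(\<Prod>k\<in>Poly_Mapping.keys n. x k ^ Poly_Mapping.lookup n k) =
      (\<Prod>k\<in>?K. x k ^ Poly_Mapping.lookup n k)" if "Poly_Mapping.keys n \<subseteq> ?K" for n
    by (rule prod.mono_neutral_left) (use that in \<open>auto simp: in_keys_iff\<close>)
  have "(\<Prod>k\<in>Poly_Mapping.keys (m + m'). x k ^ Poly_Mapping.lookup (m + m') k) =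
      (\<Prod>k\<in>?K. x k ^ Poly_Mapping.lookup (m + m') k)"
    by (rule ext[OF Poly_Mapping.keys_add])
  then show ?thesis
    by (simp add: ext[of m] ext[of m'] lookup_add power_add prod.distrib)
qed

lemma monomial_sums_mult_monomial:
  assumes "f \<in> monomial_sums I" and "Poly_Mapping.keys m \<subseteq> I"
  shows "(\<lambda>x. f x * (c * (\<Prod>k\<in>Poly_Mapping.keys m. of_int (x k) ^ Poly_Mapping.lookup m k)))
    \<in> monomial_sums I"
  using assms(1)
proof induction
  case (monomial m' c')
  have "Poly_Mapping.keys (m' + m) \<subseteq> I"
    using monomial assms(2) Poly_Mapping.keys_add[of m' m] by blast
  from monomial_sums.monomial[OF this, of "c' * c"] show ?case
    by (simp add: monomial_add mult.assoc mult.left_commute)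
next
  case (add f g)
  show ?case
    using monomial_sums.add[OF add.IH] by (simp add: distrib_right)
qed

lemma monomial_sums_mult:
  assumes "f \<in> monomial_sums I" and "g \<in> monomial_sums I"
  shows "(\<lambda>x. f x * g x) \<in> monomial_sums I"
  using assms(2)
proof induction
  case (monomial m c)
  then show ?case by (rule monomial_sums_mult_monomial[OF assms(1)])
next
  case (add g1 g2)
  show ?case
    using monomial_sums.add[OF add.IH] by (simp add: distrib_left)
qed

lemma polyfun_imp_monomial_sums:
  assumes "f \<in> polyfun I"
  shows "f \<in> monomial_sums I"
  using assms
proof induction
  case (polyfun_const c)
  show ?case using monomial_sums.monomial[of 0 I c] by simp
next
  case (polyfun_var i)
  then show ?case using monomial_sums.monomial[of "Poly_Mapping.single i 1" I 1] by simp
qed (auto intro: monomial_sums.add monomial_sums_mult)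

lemma polyfun_imp_mpoly:
  assumes "f \<in> polyfun I"
  shows "\<exists>P :: ('i, rat) mpoly. mpoly_vars P \<subseteq> I \<and> (\<forall>x. f x = mpoly_eval P (\<lambda>i. of_int (x i)))"
  using polyfun_imp_monomial_sums[OF assms]
proof induction
  case (monomial m c)
  let ?P = "Poly_Mapping.single m c"
  have "mpoly_vars ?P \<subseteq> I"
    using monomial by (auto simp: mpoly_vars_def split: if_splits)
  moreover have "mpoly_eval ?P (\<lambda>i. of_int (x i)) =
      c * (\<Prod>k\<in>Poly_Mapping.keys m. of_int (x k) ^ Poly_Mapping.lookup m k)" for x
    by (subst mpoly_eval_eq_sum[of "{m}"]) auto
  ultimately show ?case by metis
next
  case (add f g)
  then obtain P Q :: "('i, rat) mpoly"
    where "mpoly_vars P \<subseteq> I" "\<And>x. f x = mpoly_eval P (\<lambda>i. of_int (x i))"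
      and "mpoly_vars Q \<subseteq> I" "\<And>x. g x = mpoly_eval Q (\<lambda>i. of_int (x i))"
    by blast
  then show ?case
    using mpoly_vars_add[of P Q] by (intro exI[of _ "P + Q"]) (auto simp: mpoly_eval_add)
qed

section \<open>Sums over roots of unity\<close>

abbreviation unity_roots :: "nat \<Rightarrow> complex set" where
  "unity_roots r \<equiv> {z. z ^ r = 1}"

lemma unity_roots_nonzero: "r > 0 \<Longrightarrow> z \<in> unity_roots r \<Longrightarrow> z \<noteq> 0"
  by (auto simp: power_0_left)

text \<open>The primitive root \<open>cis (2 * pi / real r)\<close> suffices as a test: its powers
  with exponents below \<open>r\<close> are distinct, so \<open>k\<close> must have residue
  0.\<close>

lemma power_int_eq_1_iff_dvd:
  assumes "r > 0" and "\<And>z. z \<in> unity_roots r \<Longrightarrow> z powi k = 1"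
  shows "int r dvd k"
proof -
  let ?w = "cis (2 * pi / real r)"
  have w: "?w \<in> unity_roots r"
    using assms(1) by (auto simp: DeMoivre complex_eq_iff)
  have "inj_on (\<lambda>k. cis (2 * pi * real k / real r)) {..<r}"
    using bij_betw_roots_unity[OF assms(1)] by (rule bij_betw_imp_inj_on)
  then have inj: "inj_on (\<lambda>k. ?w ^ k) {..<r}"
    by (simp add: DeMoivre inj_on_def mult_ac)
  let ?m = "nat (k mod int r)"
  have m: "?m < r"
    using assms(1) by (simp add: nat_less_iff)
  have "1 = ?w powi (int r * (k div int r) + k mod int r)"
    using assms(2)[OF w] by (simp only: mult_div_mod_eq)
  also have "\<dots> = (?w powi int r) powi (k div int r) * ?w powi (k mod int r)"
    by (subst power_int_add) (simp_all add: power_int_mult)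
  also have "\<dots> = ?w ^ ?m"
    using w assms(1) by (simp add: power_int_def)
  finally have "?w ^ ?m = ?w ^ 0" by simp
  then have "?m = 0"
    using inj_onD[OF inj, of ?m 0] m assms(1) by simp
  then have "k mod int r = 0"
    using pos_mod_sign[of "int r" k] assms(1) by linarith
  then show ?thesis by (rule mod_0_imp_dvd)
qed

text \<open>Orthogonality of characters: if some root \<open>w\<close> has
  \<open>w powi k \<noteq> 1\<close>, multiplication by \<open>w\<close> permutes the roots and
  multiplies the sum by \<open>w powi k\<close>, so the sum vanishes.\<close>

lemma sum_unity_roots_power_int:
  assumes "r > 0"
  shows "(\<Sum>z\<in>unity_roots r. z powi k) = (if int r dvd k then of_nat r else 0)"
proof (cases "int r dvd k")
  case True
  then obtain j where "k = int r * j" by blast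
  then have "z powi k = 1" if "z \<in> unity_roots r" for z
    using that by (simp add: power_int_mult)
  then show ?thesis
    using True assms by (simp add: card_roots_unity_eq)
next
  case False
  then obtain w where w: "w \<in> unity_roots r" "w powi k \<noteq> 1"
    using power_int_eq_1_iff_dvd[OF assms] by blast
  have "w \<noteq> 0" using w unity_roots_nonzero[OF assms] by blast
  have "(\<Sum>z\<in>unity_roots r. z powi k) = (\<Sum>z\<in>unity_roots r. (w * z) powi k)"
    by (rule sum.reindex_bij_witness[of _ "\<lambda>z. w * z" "\<lambda>z. z / w"])
      (use w \<open>w \<noteq> 0\<close> in \<open>auto simp: power_mult_distrib power_divide\<close>)
  also have "\<dots> = w powi k * (\<Sum>z\<in>unity_roots r. z powi k)"
    by (simp add: power_int_mult_distrib sum_distrib_left)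
  finally show ?thesis
    using w False by simp
qed

section \<open>Power sums of \<open>inverse (1 - z)\<close> over roots of unity\<close>

text \<open>The binomials \<open>(x + j) choose j\<close> make the transition from power sums of \<open>1 / (1 - z)\<close> to sums of
  polynomials against \<open>z ^ x\<close> triangular; the shift in \<open>(r + i) choose Suc i\<close> makes it divisible
  by \<open>r\<close>.\<close>

lemma binomial_div_polynomial:
  "\<exists>p :: rat poly. \<forall>r. of_nat ((r + i) choose Suc i) = of_nat r * poly p (of_nat r)"
proof (induction i)
  case 0
  show ?case by (intro exI[of _ 1]) simp
next
  case (Suc i)
  then obtain p :: "rat poly"
    where p: "\<And>r. of_nat ((r + i) choose Suc i) = of_nat r * poly p (of_nat r)" by blast
  show ?case
  \<comment> \<open>The witness comes from \<open>(i + 2) * ((r + i + 1) choose (i + 2)) = (r + i +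
    1) * ((r + i) choose (i + 1))\<close>.\<close>
  proof (intro exI[of _ "smult (1 / of_nat (Suc (Suc i))) ([:of_nat (Suc i), 1:] * p)"] allI)
    fix r
    have "of_nat (Suc (Suc i)) * (of_nat ((r + Suc i) choose Suc (Suc i)) :: rat) =
        of_nat (Suc (r + i)) * of_nat ((r + i) choose Suc i)"
      using Suc_times_binomial[of "Suc i" "r + i"] by (simp only: of_nat_mult[symmetric] add_Suc_right)
    then show "of_nat ((r + Suc i) choose Suc (Suc i)) = (of_nat r :: rat) *
        poly (smult (1 / of_nat (Suc (Suc i))) ([:of_nat (Suc i), 1:] * p)) (of_nat r)"
      unfolding p by (simp add: field_simps del: binomial_Suc_Suc)
  qed
qed

text \<open>Summation by parts. By Pascal's rule the sum for \<open>Suc j\<close> is the sum for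
  \<open>j\<close> plus a copy of itself shifted by one place, hence multiplied by \<open>z\<close>,
  up to a boundary term; solving for it gives a factor \<open>inverse (1 - z)\<close> at each
  step.\<close>

lemma sum_binomial_unity_root:
  fixes z :: complex
  assumes "z ^ r = 1" "z \<noteq> 1"
  shows "(\<Sum>x<r. of_nat ((x + j) choose j) * z ^ x) =
    - (\<Sum>i<j. of_nat ((r + i) choose Suc i) * inverse (1 - z) ^ (j - i))"
proof (induction j)
  case 0
  show ?case using assms by (simp add: geometric_sum)
next
  case (Suc j)
  let ?D = "\<lambda>j. \<Sum>x<r. of_nat ((x + j) choose j) * z ^ x"
  let ?a = "\<lambda>x. of_nat ((x + j) choose Suc j) * z ^ x"
  have "?D (Suc j) = ?D j + (\<Sum>x<r. of_nat ((x + j) choose Suc j) * z ^ x)"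
    by (simp add: sum.distrib[symmetric] distrib_right)
  \<comment> \<open>The term at \<open>x = 0\<close> is \<open>j choose Suc j = 0\<close>, and the
    term at \<open>x = r\<close> loses its power because \<open>z ^ r = 1\<close>.\<close>
  also have "(\<Sum>x<r. ?a x) = (\<Sum>x<r. ?a (Suc x)) - of_nat ((r + j) choose Suc j)"
    using sum.lessThan_Suc[of ?a r] sum.lessThan_Suc_shift[of ?a r] assms
    by (simp add: binomial_eq_0 eq_diff_eq del: binomial_Suc_Suc)
  also have "(\<Sum>x<r. ?a (Suc x)) = z * ?D (Suc j)"
    by (simp add: sum_distrib_left mult_ac)
  finally have "(1 - z) * ?D (Suc j) = ?D j - of_nat ((r + j) choose Suc j)"
    by (simp add: algebra_simps)
  then have "?D (Suc j) = inverse (1 - z) * (?D j - of_nat ((r + j) choose Suc j))"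
    using assms(2) by (simp add: field_simps)
  also have "\<dots> = - (\<Sum>i<Suc j. of_nat ((r + i) choose Suc i) * inverse (1 - z) ^ (Suc j - i))"
    unfolding Suc.IH
    by (simp add: sum_distrib_left right_diff_distrib Suc_diff_le mult_ac
        del: binomial_Suc_Suc cong: sum.cong_simp)
  finally show ?case .
qed

text \<open>Summing \<open>((x + Suc k) choose Suc k) * z ^ x\<close> over all roots
  \<open>z\<close> and all \<open>x < r\<close> gives \<open>r\<close> by orthogonality. The root 1
  contributes a binomial coefficient, the others power sums with exponents up to
  \<open>Suc k\<close>; division by \<open>r\<close> leaves a recursion for the highest of
  these.\<close>

lemma sum_inverse_unity_roots_polynomial:
  "\<exists>p :: rat poly. \<forall>r>0. (\<Sum>z\<in>unity_roots r. inverse (1 - z) ^ Suc k) = of_rat (poly p (of_nat r))"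
proof (induction k rule: less_induct)
  case (less k)
  then obtain p :: "nat \<Rightarrow> rat poly" where
    p: "\<And>j r. j < k \<Longrightarrow> r > 0 \<Longrightarrow>
      (\<Sum>z\<in>unity_roots r. inverse (1 - z) ^ Suc j) = of_rat (poly (p j) (of_nat r))"
    by metis
  obtain c :: "nat \<Rightarrow> rat poly" where
    c: "\<And>i r. of_nat ((r + i) choose Suc i) = of_nat r * poly (c i) (of_nat r)"
    using binomial_div_polynomial by metis
  have c': "of_nat ((r + i) choose Suc i) = (of_nat r * of_rat (poly (c i) (of_nat r)) :: complex)"
    for r i
    using arg_cong[OF c[of r i], of "of_rat :: rat \<Rightarrow> complex"] by (simp add: of_rat_mult)
  \<comment> \<open>The recursion solved for the power sum of exponent \<open>Suc k\<close>, which
    enters through \<open>i = 0\<close> with the factor \<open>r choose 1 = r\<close>.\<close>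
  define P where "P = c (Suc k) - 1 - (\<Sum>i<k. c (Suc i) * p (k - Suc i))"
  have "(\<Sum>z\<in>unity_roots r. inverse (1 - z) ^ Suc k) = of_rat (poly P (of_nat r))"
    if r: "r > 0" for r
  proof -
    let ?b = "\<lambda>x. of_nat ((x + Suc k) choose Suc k) :: complex"
    let ?e = "\<lambda>k. \<Sum>z\<in>unity_roots r. inverse (1 - z) ^ k"
    have fin: "finite (unity_roots r)"
      using r by (auto intro: finite_roots_unity)
    \<comment> \<open>The root 1 contributes a positive power of
      \<open>inverse 0 = 0\<close>.\<close>
    have e: "?e (Suc j) = (\<Sum>z\<in>unity_roots r - {1}. inverse (1 - z) ^ Suc j)" for j
      by (subst sum.remove[OF fin, of 1]) auto
    have "(\<Sum>z\<in>unity_roots r. \<Sum>x<r. ?b x * z ^ x) =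
        (\<Sum>x<r. ?b x * (\<Sum>z\<in>unity_roots r. z powi (int x)))"
      by (subst sum.swap) (simp add: sum_distrib_left)
    also have "\<dots> = (\<Sum>x<r. if x = 0 then of_nat r else 0)"
      unfolding sum_unity_roots_power_int[OF r]
      by (rule sum.cong) (auto dest: nat_dvd_not_less simp del: binomial_Suc_Suc)
    also have "\<dots> = of_nat r"
      using r by (simp add: sum.delta)
    finally have "of_nat r = (\<Sum>x<r. ?b x) +
        (\<Sum>z\<in>unity_roots r - {1}. \<Sum>x<r. ?b x * z ^ x)"
      by (subst (asm) sum.remove[OF fin, of 1]) auto
    also have "(\<Sum>x<r. ?b x) = of_nat ((r + Suc k) choose Suc (Suc k))"
    proof -
      have "(\<Sum>x<r. ((x + Suc k) choose Suc k)) = (r + Suc k) choose Suc (Suc k)" for r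
        by (induction r) auto
      then show ?thesis by (simp only: of_nat_sum[symmetric])
    qed
    also have "(\<Sum>z\<in>unity_roots r - {1}. \<Sum>x<r. ?b x * z ^ x) =
        - (\<Sum>i<Suc k. of_nat ((r + i) choose Suc i) * ?e (Suc k - i))"
    proof -
      have "(\<Sum>z\<in>unity_roots r - {1}. \<Sum>x<r. ?b x * z ^ x) =
        (\<Sum>z\<in>unity_roots r - {1}.
          - (\<Sum>i<Suc k. of_nat ((r + i) choose Suc i) * inverse (1 - z) ^ (Suc k - i)))"
        by (intro sum.cong refl sum_binomial_unity_root) auto
      also have "\<dots> = - (\<Sum>i<Suc k. of_nat ((r + i) choose Suc i) *
          (\<Sum>z\<in>unity_roots r - {1}. inverse (1 - z) ^ (Suc k - i)))"
        by (subst sum_negf, subst sum.swap) (simp add: sum_distrib_left)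
      also have "\<dots> = - (\<Sum>i<Suc k. of_nat ((r + i) choose Suc i) * ?e (Suc k - i))"
        by (intro arg_cong[of _ _ uminus] sum.cong refl)
          (simp only: e Suc_diff_le lessThan_iff less_Suc_eq_le)
      finally show ?thesis .
    qed
    also have "(\<Sum>i<Suc k. of_nat ((r + i) choose Suc i) * ?e (Suc k - i)) =
        of_nat r * (?e (Suc k) + (\<Sum>i<k. of_rat (poly (c (Suc i)) (of_nat r)) * ?e (k - i)))"
      by (subst sum.lessThan_Suc_shift) (simp add: c' sum_distrib_left distrib_left mult_ac del: binomial_Suc_Suc add_Suc_right)
    also have "(\<Sum>i<k. of_rat (poly (c (Suc i)) (of_nat r)) * ?e (k - i)) =
        (\<Sum>i<k. of_rat (poly (c (Suc i) * p (k - Suc i)) (of_nat r)))"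
    proof (intro sum.cong refl)
      fix i assume "i \<in> {..<k}"
      then have "?e (k - i) = of_rat (poly (p (k - Suc i)) (of_nat r))"
        using p[of "k - Suc i" r] r by (simp add: Suc_diff_Suc)
      then show "of_rat (poly (c (Suc i)) (of_nat r)) * ?e (k - i) =
          of_rat (poly (c (Suc i) * p (k - Suc i)) (of_nat r))"
        by (simp add: of_rat_mult)
    qed
    finally have "of_nat r * (1 :: complex) = of_nat r * (of_rat (poly (c (Suc k)) (of_nat r)) -
        (?e (Suc k) + (\<Sum>i<k. of_rat (poly (c (Suc i) * p (k - Suc i)) (of_nat r)))))"
      by (simp only: c' right_diff_distrib) simp
    then have "1 = of_rat (poly (c (Suc k)) (of_nat r)) -
        (?e (Suc k) + (\<Sum>i<k. of_rat (poly (c (Suc i) * p (k - Suc i)) (of_nat r))))"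
      using r by simp
    then show ?thesis
      by (simp add: P_def poly_sum of_rat_sum of_rat_diff of_rat_add algebra_simps)
  qed
  then show ?case by blast
qed

section \<open>Functions of families of roots of unity and elimination of a vertex\<close>

text \<open>Here \<open>\<kappa>\<close> names the connected component of a vertex: only vertices of the same component may
  interact, which yields one factor \<open>r\<close> for each component in the end. For \<open>\<zeta> u = \<zeta> v\<close> the third
  generator is \<open>inverse 0 = 0\<close>.\<close>

inductive_set root_fun :: "('v \<Rightarrow> 'k) \<Rightarrow> 'v set \<Rightarrow> (nat \<Rightarrow> ('v \<Rightarrow> complex) \<Rightarrow> complex) set"
  for \<kappa> W where
  coeff: "(\<lambda>r \<zeta>. of_rat (poly p (of_nat r))) \<in> root_fun \<kappa> W"
| ind: "u \<in> W \<Longrightarrow> v \<in> W \<Longrightarrow> \<kappa> u = \<kappa> v \<Longrightarrow> (\<lambda>r \<zeta>. of_bool (\<zeta> u = \<zeta> v)) \<in> root_fun \<kappa> W"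
| inv: "u \<in> W \<Longrightarrow> v \<in> W \<Longrightarrow> \<kappa> u = \<kappa> v \<Longrightarrow> (\<lambda>r \<zeta>. inverse (1 - \<zeta> u / \<zeta> v)) \<in> root_fun \<kappa> W"
| add: "F \<in> root_fun \<kappa> W \<Longrightarrow> G \<in> root_fun \<kappa> W \<Longrightarrow> (\<lambda>r \<zeta>. F r \<zeta> + G r \<zeta>) \<in> root_fun \<kappa> W"
| mult: "F \<in> root_fun \<kappa> W \<Longrightarrow> G \<in> root_fun \<kappa> W \<Longrightarrow> (\<lambda>r \<zeta>. F r \<zeta> * G r \<zeta>) \<in> root_fun \<kappa> W"

lemma root_fun_of_int: "(\<lambda>r \<zeta>. of_int c) \<in> root_fun \<kappa> W"
  using root_fun.coeff[of "[:of_int c:]"] by simp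

lemmas root_fun_1 = root_fun_of_int[of 1, simplified]

lemma root_fun_diff:
  "F \<in> root_fun \<kappa> W \<Longrightarrow> G \<in> root_fun \<kappa> W \<Longrightarrow> (\<lambda>r \<zeta>. F r \<zeta> - G r \<zeta>) \<in> root_fun \<kappa> W"
  using root_fun.add[OF _ root_fun.mult[OF root_fun_of_int[of "-1"]]] by simp

lemma root_fun_power:
  "F \<in> root_fun \<kappa> W \<Longrightarrow> (\<lambda>r \<zeta>. F r \<zeta> ^ k) \<in> root_fun \<kappa> W"
  by (induction k) (auto intro: root_fun.mult root_fun_1)

lemma root_fun_prod:
  "(\<And>e. e \<in> S \<Longrightarrow> F e \<in> root_fun \<kappa> W) \<Longrightarrow> (\<lambda>r \<zeta>. \<Prod>e\<in>S. F e r \<zeta>) \<in> root_fun \<kappa> W"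
  by (induction S rule: infinite_finite_induct) (auto intro: root_fun.mult root_fun_1)

lemma root_fun_cong:
  "F \<in> root_fun \<kappa> W \<Longrightarrow> (\<And>w. w \<in> W \<Longrightarrow> \<zeta> w = \<zeta>' w) \<Longrightarrow> F r \<zeta> = F r \<zeta>'"
  by (induction rule: root_fun.induct) auto

lemma root_fun_empty:
  "F \<in> root_fun \<kappa> {} \<Longrightarrow> \<exists>p :: rat poly. \<forall>r \<zeta>. F r \<zeta> = of_rat (poly p (of_nat r))"
proof (induction rule: root_fun.induct)
  case (add F G)
  then obtain p q :: "rat poly" where "\<And>r \<zeta>. F r \<zeta> = of_rat (poly p (of_nat r))"
    "\<And>r \<zeta>. G r \<zeta> = of_rat (poly q (of_nat r))" by blast
  then show ?case by (intro exI[of _ "p + q"]) (simp add: of_rat_add)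
next
  case (mult F G)
  then obtain p q :: "rat poly" where "\<And>r \<zeta>. F r \<zeta> = of_rat (poly p (of_nat r))"
    "\<And>r \<zeta>. G r \<zeta> = of_rat (poly q (of_nat r))" by blast
  then show ?case by (intro exI[of _ "p * q"]) (simp add: of_rat_mult)
qed auto

text \<open>Partial fraction form in \<open>\<zeta> v\<close>: no term mixes two poles, or a pole
  and an indicator, in \<open>\<zeta> v\<close>, so that summation over \<open>\<zeta> v\<close>
  works term by term. The rule \<open>cong\<close> admits identities valid only at nonzero
  arguments, which roots of unity are.\<close>

inductive_set vertex_expansion ::
  "('v \<Rightarrow> 'k) \<Rightarrow> 'v \<Rightarrow> 'v set \<Rightarrow> (nat \<Rightarrow> ('v \<Rightarrow> complex) \<Rightarrow> complex) set"
  for \<kappa> v W where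
  base: "G \<in> root_fun \<kappa> W \<Longrightarrow> G \<in> vertex_expansion \<kappa> v W"
| ind: "G \<in> root_fun \<kappa> W \<Longrightarrow> u \<in> W \<Longrightarrow> \<kappa> u = \<kappa> v \<Longrightarrow>
    (\<lambda>r \<zeta>. G r \<zeta> * of_bool (\<zeta> v = \<zeta> u)) \<in> vertex_expansion \<kappa> v W"
| inv: "G \<in> root_fun \<kappa> W \<Longrightarrow> u \<in> W \<Longrightarrow> \<kappa> u = \<kappa> v \<Longrightarrow>
    (\<lambda>r \<zeta>. G r \<zeta> * inverse (1 - \<zeta> v / \<zeta> u) ^ Suc k) \<in> vertex_expansion \<kappa> v W"
| add: "F \<in> vertex_expansion \<kappa> v W \<Longrightarrow> G \<in> vertex_expansion \<kappa> v W \<Longrightarrow>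
    (\<lambda>r \<zeta>. F r \<zeta> + G r \<zeta>) \<in> vertex_expansion \<kappa> v W"
| cong: "F \<in> vertex_expansion \<kappa> v W \<Longrightarrow>
    (\<And>r \<zeta>. (\<And>w. w \<in> insert v W \<Longrightarrow> \<zeta> w \<noteq> 0) \<Longrightarrow> F r \<zeta> = G r \<zeta>) \<Longrightarrow>
    G \<in> vertex_expansion \<kappa> v W"

lemma vertex_expansion_mult_root_fun:
  assumes "F \<in> vertex_expansion \<kappa> v W" and G: "G \<in> root_fun \<kappa> W"
  shows "(\<lambda>r \<zeta>. F r \<zeta> * G r \<zeta>) \<in> vertex_expansion \<kappa> v W"
  using assms(1)
proof induction
  case (base F)
  show ?case by (intro vertex_expansion.base root_fun.mult base G)
next
  case (ind F u)
  from vertex_expansion.ind[OF root_fun.mult[OF ind(1) G] ind(2,3)] show ?case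
    by (simp add: mult_ac)
next
  case (inv F u k)
  from vertex_expansion.inv[OF root_fun.mult[OF inv(1) G] inv(2,3), of k] show ?case
    by (simp add: mult_ac)
next
  case (add F1 F2)
  from vertex_expansion.add[OF add.IH] show ?case
    by (simp add: distrib_right)
next
  case (cong F F')
  show ?case
    by (rule vertex_expansion.cong[OF cong.IH]) (metis cong.hyps(2))
qed

lemma vertex_expansion_diff:
  assumes "F \<in> vertex_expansion \<kappa> v W" and "G \<in> vertex_expansion \<kappa> v W"
  shows "(\<lambda>r \<zeta>. F r \<zeta> - G r \<zeta>) \<in> vertex_expansion \<kappa> v W"
  using vertex_expansion.add[OF assms(1)
      vertex_expansion_mult_root_fun[OF assms(2) root_fun_of_int[of "-1"]]] by simp

text \<open>Where the indicator is nonzero, \<open>\<zeta> v\<close> may be replaced by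
  \<open>\<zeta> u\<close>, which turns the other factor into a function on
  \<open>W\<close>.\<close>

lemma vertex_expansion_mult_ind:
  assumes "F \<in> vertex_expansion \<kappa> v W" and u: "u \<in> W" "\<kappa> u = \<kappa> v"
  shows "(\<lambda>r \<zeta>. F r \<zeta> * of_bool (\<zeta> v = \<zeta> u)) \<in> vertex_expansion \<kappa> v W"
  using assms(1)
proof induction
  case (base F)
  show ?case by (rule vertex_expansion.ind[OF base u])
next
  case (ind F u')
  have "(\<lambda>r \<zeta>. F r \<zeta> * of_bool (\<zeta> u' = \<zeta> u)) \<in> root_fun \<kappa> W"
    using ind u by (intro root_fun.mult root_fun.ind) auto
  from vertex_expansion.ind[OF this u] show ?case
    by (rule vertex_expansion.cong) auto
next
  case (inv F u' k)
  have "(\<lambda>r \<zeta>. F r \<zeta> * inverse (1 - \<zeta> u / \<zeta> u') ^ Suc k) \<in> root_fun \<kappa> W"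
    using inv u by (intro root_fun.mult root_fun_power root_fun.inv) auto
  from vertex_expansion.ind[OF this u] show ?case
    by (rule vertex_expansion.cong) auto
next
  case (add F1 F2)
  from vertex_expansion.add[OF add.IH] show ?case
    by (simp add: distrib_right)
next
  case (cong F F')
  show ?case
    by (rule vertex_expansion.cong[OF cong.IH]) (metis cong.hyps(2))
qed

text \<open>For pairwise distinct arguments this is \<open>a * b = c * a + (1 - c) * b\<close>; the indicators correct
  the cases where one of the denominators vanishes.\<close>

lemma inverse_partial_fraction:
  fixes x y z :: complex
  assumes "x \<noteq> 0" "y \<noteq> 0" "z \<noteq> 0"
  defines "a \<equiv> inverse (1 - z / x)" and "b \<equiv> inverse (1 - z / y)" and "c \<equiv> inverse (1 - x / y)"
  shows "a * b = of_bool (x = y) * a ^ 2 + (1 - of_bool (x = y)) *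
    (c * a + (1 - c) * b - (1 - c) * c * of_bool (z = x) - (1 - c) * c * of_bool (z = y))"
proof -
  consider "x = y" | "x \<noteq> y" "z = x" | "x \<noteq> y" "z = y" | "x \<noteq> y" "z \<noteq> x" "z \<noteq> y" by blast
  then show ?thesis
  proof cases
    case 1
    then show ?thesis by (simp add: a_def b_def power2_eq_square)
  next
    case 2
    then show ?thesis by (simp add: a_def b_def c_def)
  next
    case 3
    \<comment> \<open>Here \<open>b = 0\<close>, and \<open>a = 1 - c\<close> lets the second
      indicator term cancel \<open>c * a\<close>.\<close>
    have "inverse (1 - y / x) = 1 - inverse (1 - x / y)"
      using assms 3 by (simp add: divide_simps) (simp add: algebra_simps)
    then show ?thesis using 3 by (simp add: a_def b_def c_def)
  next
    case 4
    then have "1 - z / x \<noteq> 0" "1 - z / y \<noteq> 0" "1 - x / y \<noteq> 0"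
      using assms by auto
    moreover have a: "a = x / (x - z)" "b = y / (y - z)" "c = y / (y - x)"
      using 4 assms by (auto simp: a_def b_def c_def divide_simps)
    have "x - z \<noteq> 0" "y - z \<noteq> 0" "y - x \<noteq> 0" using 4 by auto
    then have "a * b = c * a + (1 - c) * b"
      unfolding a by (simp add: divide_simps) (simp add: algebra_simps)
    then show ?thesis using 4 by simp
  qed
qed

text \<open>One partial fraction step leaves the two poles together only in a term with exponent
  \<open>k\<close> instead of \<open>Suc k\<close>; every other term has at most one pole or carries
  an indicator. \<open>G\<close> is generalised to absorb the new coefficients.\<close>

lemma vertex_expansion_inv_inv:
  assumes u: "u \<in> W" "\<kappa> u = \<kappa> v" and u': "u' \<in> W" "\<kappa> u' = \<kappa> v"
    and "G \<in> root_fun \<kappa> W"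
  shows "(\<lambda>r \<zeta>. G r \<zeta> * inverse (1 - \<zeta> v / \<zeta> u') ^ k * inverse (1 - \<zeta> v / \<zeta> u))
    \<in> vertex_expansion \<kappa> v W"
  using assms(5)
proof (induction k arbitrary: G)
  case 0
  from vertex_expansion.inv[OF 0 u, of 0] show ?case by simp
next
  case (Suc k)
  define I :: "nat \<Rightarrow> ('a \<Rightarrow> complex) \<Rightarrow> complex" where "I r \<zeta> = of_bool (\<zeta> u' = \<zeta> u)" for r \<zeta>
  define c where "c r \<zeta> = inverse (1 - \<zeta> u' / \<zeta> u)" for r :: nat and \<zeta> :: "'a \<Rightarrow> complex"
  have I: "I \<in> root_fun \<kappa> W" and c: "c \<in> root_fun \<kappa> W"
    unfolding I_def c_def by (intro root_fun.ind root_fun.inv; use u u' in simp)+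
  have pow: "(\<lambda>r \<zeta>. H r \<zeta> * inverse (1 - \<zeta> v / \<zeta> u') ^ j) \<in> vertex_expansion \<kappa> v W"
    if "H \<in> root_fun \<kappa> W" for H j
    using vertex_expansion.inv[OF that u'] vertex_expansion.base[OF that] by (cases j) auto
  have 1: "(\<lambda>r \<zeta>. (G r \<zeta> * I r \<zeta>) * inverse (1 - \<zeta> v / \<zeta> u') ^ (k + 2)) \<in> vertex_expansion \<kappa> v W"
    by (intro pow root_fun.mult Suc.prems I)
  have 2: "(\<lambda>r \<zeta>. (G r \<zeta> * (1 - I r \<zeta>) * c r \<zeta>) * inverse (1 - \<zeta> v / \<zeta> u') ^ (k + 1))
      \<in> vertex_expansion \<kappa> v W"
    by (intro pow root_fun.mult root_fun_diff root_fun_1 Suc.prems I c)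
  have 3: "(\<lambda>r \<zeta>. (G r \<zeta> * (1 - I r \<zeta>) * (1 - c r \<zeta>)) * inverse (1 - \<zeta> v / \<zeta> u') ^ k *
      inverse (1 - \<zeta> v / \<zeta> u)) \<in> vertex_expansion \<kappa> v W"
    by (intro Suc.IH root_fun.mult root_fun_diff root_fun_1 Suc.prems I c)
  have 4: "(\<lambda>r \<zeta>. (G r \<zeta> * (1 - I r \<zeta>) * ((1 - c r \<zeta>) * c r \<zeta>)) *
      inverse (1 - \<zeta> v / \<zeta> u') ^ k) \<in> vertex_expansion \<kappa> v W"
    by (intro pow root_fun.mult root_fun_diff root_fun_1 Suc.prems I c)
  note 5 = vertex_expansion_mult_ind[OF 4 u'] and 6 = vertex_expansion_mult_ind[OF 4 u]
  note sum = vertex_expansion_diff[OF vertex_expansion_diff[OF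
        vertex_expansion.add[OF 1 vertex_expansion.add[OF 2 3]] 5] 6]
  show ?case
  proof (rule vertex_expansion.cong[OF sum], goal_cases)
    case (1 r \<zeta>)
    have nz: "\<zeta> u' \<noteq> 0" "\<zeta> u \<noteq> 0" "\<zeta> v \<noteq> 0" using 1 u u' by auto
    have "G r \<zeta> * inverse (1 - \<zeta> v / \<zeta> u') ^ Suc k * inverse (1 - \<zeta> v / \<zeta> u) =
        G r \<zeta> * inverse (1 - \<zeta> v / \<zeta> u') ^ k *
          (inverse (1 - \<zeta> v / \<zeta> u') * inverse (1 - \<zeta> v / \<zeta> u))" by simp
    also note inverse_partial_fraction[OF nz]
    finally show ?case
      unfolding I_def c_def by (simp add: algebra_simps power2_eq_square del: inverse_mult_distrib)
  qed
qed

lemma vertex_expansion_mult_inv: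
  assumes "F \<in> vertex_expansion \<kappa> v W" and u: "u \<in> W" "\<kappa> u = \<kappa> v"
  shows "(\<lambda>r \<zeta>. F r \<zeta> * inverse (1 - \<zeta> v / \<zeta> u)) \<in> vertex_expansion \<kappa> v W"
  using assms(1)
proof induction
  case (base F)
  from vertex_expansion.inv[OF base u, of 0] show ?case by simp
next
  case (ind F u')
  have "(\<lambda>r \<zeta>. F r \<zeta> * inverse (1 - \<zeta> u' / \<zeta> u)) \<in> root_fun \<kappa> W"
    using ind u by (intro root_fun.mult root_fun.inv) auto
  from vertex_expansion.ind[OF this ind(2,3)] show ?case
    by (rule vertex_expansion.cong) auto
next
  case (inv F u' k)
  then show ?case by (intro vertex_expansion_inv_inv u)
next
  case (add F1 F2)
  from vertex_expansion.add[OF add.IH] show ?case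
    by (simp add: distrib_right)
next
  case (cong F F')
  show ?case
    by (rule vertex_expansion.cong[OF cong.IH]) (metis cong.hyps(2))
qed

lemma vertex_expansion_mult:
  assumes F: "F \<in> vertex_expansion \<kappa> v W" and "G \<in> vertex_expansion \<kappa> v W"
  shows "(\<lambda>r \<zeta>. F r \<zeta> * G r \<zeta>) \<in> vertex_expansion \<kappa> v W"
  using assms(2)
proof induction
  case (base G)
  then show ?case by (rule vertex_expansion_mult_root_fun[OF F])
next
  case (ind G u)
  from vertex_expansion_mult_ind[OF vertex_expansion_mult_root_fun[OF F ind(1)] ind(2,3)]
  show ?case by (simp add: mult.assoc)
next
  case (inv G u k)
  have "(\<lambda>r \<zeta>. F r \<zeta> * G r \<zeta> * inverse (1 - \<zeta> v / \<zeta> u) ^ j) \<in> vertex_expansion \<kappa> v W" for j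
  proof (induction j)
    case 0
    then show ?case using vertex_expansion_mult_root_fun[OF F inv(1)] by simp
  next
    case (Suc j)
    from vertex_expansion_mult_inv[OF Suc inv(2,3)] show ?case by (simp add: mult_ac)
  qed
  then show ?case by (simp only: mult.assoc)
next
  case (add G1 G2)
  from vertex_expansion.add[OF add.IH] show ?case
    by (simp add: distrib_left)
next
  case (cong G G')
  show ?case
    by (rule vertex_expansion.cong[OF cong.IH]) (metis cong.hyps(2))
qed

lemma root_fun_imp_vertex_expansion:
  assumes "F \<in> root_fun \<kappa> (insert v W)"
  shows "F \<in> vertex_expansion \<kappa> v W"
  using assms
proof induction
  case (coeff p)
  show ?case by (intro vertex_expansion.base root_fun.coeff)
next
  case (ind u w)
  have 1: "(\<lambda>r \<zeta>. 1) \<in> vertex_expansion \<kappa> v W"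
    by (intro vertex_expansion.base root_fun_1)
  consider "u = v" "w = v" | "u = v" "w \<in> W" | "u \<in> W" "w = v" | "u \<in> W" "w \<in> W"
    using ind by blast
  then show ?case
  proof cases
    case 2
    then show ?thesis using vertex_expansion_mult_ind[OF 1, of w] ind by simp
  next
    case 3
    then show ?thesis using vertex_expansion_mult_ind[OF 1, of u] ind by (simp add: eq_commute)
  qed (use 1 ind in \<open>auto intro: vertex_expansion.base root_fun.ind\<close>)
next
  case (inv u w)
  have 1: "(\<lambda>r \<zeta>. 1) \<in> vertex_expansion \<kappa> v W"
    by (intro vertex_expansion.base root_fun_1)
  consider "u = v" "w = v" | "u = v" "w \<in> W" | "u \<in> W" "w = v" | "u \<in> W" "w \<in> W"
    using inv by blast
  then show ?case
  proof cases
    case 1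
    show ?thesis
      by (rule vertex_expansion.cong[OF vertex_expansion.base[OF root_fun_of_int[of 0]]])
        (use 1 in simp)
  next
    case 2
    then show ?thesis using vertex_expansion_mult_inv[OF 1, of w] inv by simp
  next
    case 3
    \<comment> \<open>With \<open>y = \<zeta> v / \<zeta> u\<close>, this is
      \<open>inverse (1 - 1 / y) = 1 - inverse (1 - y)\<close>; the indicator corrects
      \<open>y = 1\<close>, where both inverses are 0.\<close>
    have "(\<lambda>r \<zeta>. 1 - 1 * of_bool (\<zeta> v = \<zeta> u) - 1 * inverse (1 - \<zeta> v / \<zeta> u)) \<in>
        vertex_expansion \<kappa> v W"
      using 3 inv
      by (intro vertex_expansion_diff vertex_expansion_mult_ind vertex_expansion_mult_inv 1) auto
    then show ?thesis
    proof (rule vertex_expansion.cong)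
      fix \<zeta> :: "'a \<Rightarrow> complex" assume "\<And>w. w \<in> insert v W \<Longrightarrow> \<zeta> w \<noteq> 0"
      then have "\<zeta> u \<noteq> 0" "\<zeta> v \<noteq> 0" using 3 by auto
      then show "1 - 1 * of_bool (\<zeta> v = \<zeta> u) - 1 * inverse (1 - \<zeta> v / \<zeta> u) =
          inverse (1 - \<zeta> u / \<zeta> w)"
        using 3 by (cases "\<zeta> v = \<zeta> u") (auto simp: divide_simps, simp add: algebra_simps)
    qed
  qed (use 1 inv in \<open>auto intro: vertex_expansion.base root_fun.inv\<close>)
qed (auto intro: vertex_expansion.add vertex_expansion_mult)

text \<open>A term free of \<open>\<zeta> v\<close> gains a factor \<open>r\<close>, an indicator
  sums to 1, and a pole becomes a power sum of \<open>inverse (1 - z)\<close> after rotation by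
  \<open>\<zeta> u\<close>. The factor \<open>r\<close> is kept apart only if \<open>W\<close> has
  no vertex in the component of \<open>v\<close>, and then neither indicators nor poles in
  \<open>\<zeta> v\<close> can occur.\<close>

lemma vertex_expansion_sum:
  assumes "F \<in> vertex_expansion \<kappa> v W" and "v \<notin> W"
  shows "\<exists>G\<in>root_fun \<kappa> W. \<forall>r>0. \<forall>\<zeta>\<in>W \<rightarrow> unity_roots r.
    (\<Sum>z\<in>unity_roots r. F r (\<zeta>(v := z))) = (if \<kappa> v \<in> \<kappa> ` W then 1 else of_nat r) * G r \<zeta>"
  using assms(1)
proof induction
  case (base G)
  have G: "G r (\<zeta>(v := z)) = G r \<zeta>" for r \<zeta> z
    by (rule root_fun_cong[OF base]) (use assms(2) in auto)
  show ?case
  proof (cases "\<kappa> v \<in> \<kappa> ` W")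
    case True
    \<comment> \<open>With further vertices in the component, the factor \<open>r\<close> is
      absorbed as the coefficient polynomial \<open>[:0, 1:]\<close>.\<close>
    have "(\<lambda>r \<zeta>. of_rat (poly [:0, 1:] (of_nat r)) * G r \<zeta>) \<in> root_fun \<kappa> W"
      by (intro root_fun.mult root_fun.coeff base)
    then show ?thesis
      by (rule bexI[rotated]) (use True in \<open>simp only: G, simp add: card_roots_unity_eq\<close>)
  next
    case False
    then show ?thesis
      by (intro bexI[OF _ base]) (simp only: G, simp add: card_roots_unity_eq)
  qed
next
  case (ind G u)
  have G: "G r (\<zeta>(v := z)) = G r \<zeta>" for r \<zeta> z
    by (rule root_fun_cong[OF ind(1)]) (use assms(2) in auto)
  have "\<kappa> v \<in> \<kappa> ` W" "u \<noteq> v" using ind assms(2) by (auto simp: image_iff intro: bexI[of _ u])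
  moreover have "(\<Sum>z\<in>unity_roots r. of_bool (z = \<zeta> u)) = (1 :: complex)"
    if "r > 0" "\<zeta> \<in> W \<rightarrow> unity_roots r" for r \<zeta>
  proof -
    have "\<zeta> u \<in> unity_roots r" using that ind by auto
    then show ?thesis
      using that finite_roots_unity[of r, where 'a = complex] by (simp add: of_bool_def sum.delta)
  qed
  ultimately show ?case
    by (intro bexI[OF _ ind(1)]) (simp only: G fun_upd_same fun_upd_other sum_distrib_left[symmetric], simp)
next
  case (inv G u k)
  have G: "G r (\<zeta>(v := z)) = G r \<zeta>" for r \<zeta> z
    by (rule root_fun_cong[OF inv(1)]) (use assms(2) in auto)
  obtain p :: "rat poly" where
    p: "\<And>r. r > 0 \<Longrightarrow> (\<Sum>z\<in>unity_roots r. inverse (1 - z) ^ Suc k) = of_rat (poly p (of_nat r))"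
    using sum_inverse_unity_roots_polynomial by blast
  have "\<kappa> v \<in> \<kappa> ` W" "u \<noteq> v" using inv assms(2) by (auto simp: image_iff intro: bexI[of _ u])
  moreover have "(\<Sum>z\<in>unity_roots r. inverse (1 - z / \<zeta> u) ^ Suc k) = of_rat (poly p (of_nat r))"
    if r: "r > 0" "\<zeta> \<in> W \<rightarrow> unity_roots r" for r \<zeta>
  proof -
    have u: "\<zeta> u \<in> unity_roots r" using that inv by auto
    then have "\<zeta> u \<noteq> 0" using r unity_roots_nonzero by blast
    have "(\<Sum>z\<in>unity_roots r. inverse (1 - z / \<zeta> u) ^ Suc k) =
        (\<Sum>z\<in>unity_roots r. inverse (1 - z) ^ Suc k)"
      by (rule sum.reindex_bij_witness[of _ "\<lambda>z. z * \<zeta> u" "\<lambda>z. z / \<zeta> u"])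
        (use u \<open>\<zeta> u \<noteq> 0\<close> in \<open>auto simp: power_mult_distrib power_divide\<close>)
    then show ?thesis using p r by simp
  qed
  moreover have "(\<Sum>z\<in>unity_roots r. G r (\<zeta>(v := z)) *
      inverse (1 - (\<zeta>(v := z)) v / (\<zeta>(v := z)) u) ^ Suc k) =
      G r \<zeta> * (\<Sum>z\<in>unity_roots r. inverse (1 - z / \<zeta> u) ^ Suc k)" if "u \<noteq> v" for r \<zeta>
    by (simp only: G fun_upd_same fun_upd_other[OF that] sum_distrib_left)
  ultimately have "(\<Sum>z\<in>unity_roots r. G r (\<zeta>(v := z)) *
      inverse (1 - (\<zeta>(v := z)) v / (\<zeta>(v := z)) u) ^ Suc k) =
      (if \<kappa> v \<in> \<kappa> ` W then 1 else of_nat r) * (G r \<zeta> * of_rat (poly p (of_nat r)))"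
    if "r > 0" "\<zeta> \<in> W \<rightarrow> unity_roots r" for r \<zeta>
    using that by (simp only: if_True mult_1_left not_False_eq_True)
  moreover have "(\<lambda>r \<zeta>. G r \<zeta> * of_rat (poly p (of_nat r))) \<in> root_fun \<kappa> W"
    by (intro root_fun.mult root_fun.coeff inv)
  ultimately show ?case
    by (intro bexI[of _ "\<lambda>r \<zeta>. G r \<zeta> * of_rat (poly p (of_nat r))"] allI impI ballI)
next
  case (add F1 F2)
  from add.IH(1) obtain G1 where G1: "G1 \<in> root_fun \<kappa> W"
    and 1: "\<And>r \<zeta>. r > 0 \<Longrightarrow> \<zeta> \<in> W \<rightarrow> unity_roots r \<Longrightarrow>
      (\<Sum>z\<in>unity_roots r. F1 r (\<zeta>(v := z))) = (if \<kappa> v \<in> \<kappa> ` W then 1 else of_nat r) * G1 r \<zeta>"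
    by blast
  from add.IH(2) obtain G2 where G2: "G2 \<in> root_fun \<kappa> W"
    and 2: "\<And>r \<zeta>. r > 0 \<Longrightarrow> \<zeta> \<in> W \<rightarrow> unity_roots r \<Longrightarrow>
      (\<Sum>z\<in>unity_roots r. F2 r (\<zeta>(v := z))) = (if \<kappa> v \<in> \<kappa> ` W then 1 else of_nat r) * G2 r \<zeta>"
    by blast
  show ?case
    by (rule bexI[OF _ root_fun.add[OF G1 G2]], intro allI impI ballI)
      (simp only: sum.distrib 1 2 distrib_left)
next
  case (cong F F')
  from cong.IH obtain G where G: "G \<in> root_fun \<kappa> W"
    and *: "\<And>r \<zeta>. r > 0 \<Longrightarrow> \<zeta> \<in> W \<rightarrow> unity_roots r \<Longrightarrow>
      (\<Sum>z\<in>unity_roots r. F r (\<zeta>(v := z))) = (if \<kappa> v \<in> \<kappa> ` W then 1 else of_nat r) * G r \<zeta>"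
    by blast
  have "(\<Sum>z\<in>unity_roots r. F' r (\<zeta>(v := z))) = (\<Sum>z\<in>unity_roots r. F r (\<zeta>(v := z)))"
    if r: "r > 0" "\<zeta> \<in> W \<rightarrow> unity_roots r" for r \<zeta>
  proof (intro sum.cong refl cong.hyps(2)[symmetric])
    fix z w assume "z \<in> unity_roots r" "w \<in> insert v W"
    then have "(\<zeta>(v := z)) w \<in> unity_roots r" using r by (auto simp: Pi_iff)
    then show "(\<zeta>(v := z)) w \<noteq> 0" using unity_roots_nonzero r(1) by blast
  qed
  with * show ?case
    by (intro bexI[OF _ G] allI impI ballI) (simp only:)
qed

lemma sum_PiE_insert:
  assumes "v \<notin> W"
  shows "(\<Sum>\<zeta>\<in>PiE (insert v W) B. f \<zeta>) = (\<Sum>\<zeta>\<in>PiE W B. \<Sum>z\<in>B v. f (\<zeta>(v := z)))"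
proof -
  have inj: "inj_on (\<lambda>(z, \<zeta>). \<zeta>(v := z)) (B v \<times> PiE W B)"
    using inj_combinator[OF assms] .
  have "(\<Sum>\<zeta>\<in>PiE (insert v W) B. f \<zeta>) = (\<Sum>(z, \<zeta>)\<in>B v \<times> PiE W B. f (\<zeta>(v := z)))"
    unfolding PiE_insert_eq by (subst sum.reindex[OF inj]) (simp add: case_prod_unfold)
  also have "\<dots> = (\<Sum>z\<in>B v. \<Sum>\<zeta>\<in>PiE W B. f (\<zeta>(v := z)))"
    by (simp add: sum.cartesian_product)
  finally show ?thesis by (subst sum.swap)
qed

text \<open>The vertices are summed out one by one; a separate factor \<open>r\<close> arises
  exactly when the vertex removed is the last of its component.\<close>

lemma root_fun_sum_polynomial:
  assumes "finite V" and "F \<in> root_fun \<kappa> V"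
  shows "\<exists>p :: rat poly. \<forall>r>0. (\<Sum>\<zeta>\<in>V \<rightarrow>\<^sub>E unity_roots r. F r \<zeta>) =
    of_nat r ^ card (\<kappa> ` V) * of_rat (poly p (of_nat r))"
  using assms
proof (induction V arbitrary: F rule: finite_induct)
  case empty
  from root_fun_empty[OF this] show ?case by auto
next
  case (insert v W)
  obtain G where G: "G \<in> root_fun \<kappa> W"
    and sum: "\<And>r \<zeta>. r > 0 \<Longrightarrow> \<zeta> \<in> W \<rightarrow> unity_roots r \<Longrightarrow>
      (\<Sum>z\<in>unity_roots r. F r (\<zeta>(v := z))) = (if \<kappa> v \<in> \<kappa> ` W then 1 else of_nat r) * G r \<zeta>"
    using vertex_expansion_sum[OF root_fun_imp_vertex_expansion[OF insert.prems] insert.hyps(2)]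
    by blast
  obtain p :: "rat poly" where p: "\<And>r. r > 0 \<Longrightarrow> (\<Sum>\<zeta>\<in>W \<rightarrow>\<^sub>E unity_roots r. G r \<zeta>) =
      of_nat r ^ card (\<kappa> ` W) * of_rat (poly p (of_nat r))"
    using insert.IH[OF G] by blast
  have "(\<Sum>\<zeta>\<in>insert v W \<rightarrow>\<^sub>E unity_roots r. F r \<zeta>) =
      of_nat r ^ card (\<kappa> ` insert v W) * of_rat (poly p (of_nat r))" if r: "r > 0" for r
  proof -
    have "(\<Sum>\<zeta>\<in>insert v W \<rightarrow>\<^sub>E unity_roots r. F r \<zeta>) =
        (\<Sum>\<zeta>\<in>W \<rightarrow>\<^sub>E unity_roots r. (if \<kappa> v \<in> \<kappa> ` W then 1 else of_nat r) * G r \<zeta>)"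
      unfolding sum_PiE_insert[OF insert.hyps(2)]
      by (intro sum.cong refl sum r) auto
    also have "\<dots> = (if \<kappa> v \<in> \<kappa> ` W then 1 else of_nat r) *
        (of_nat r ^ card (\<kappa> ` W) * of_rat (poly p (of_nat r)))"
      by (simp only: sum_distrib_left[symmetric] p[OF r])
    also have "\<dots> = of_nat r ^ card (\<kappa> ` insert v W) * of_rat (poly p (of_nat r))"
      using insert.hyps by (simp add: insert_absorb card_insert_if)
    finally show ?thesis .
  qed
  then show ?case by blast
qed

section \<open>Flows modulo r on directed multigraphs\<close>

definition difference :: "rat poly \<Rightarrow> rat poly" where
  "difference q = pcompose q [:1, 1:] - q"

lemma poly_difference: "poly (difference q) x = poly q (x + 1) - poly q x"
  by (simp add: difference_def poly_pcompose add.commute)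

lemma difference_eq_0: "degree q = 0 \<Longrightarrow> difference q = 0"
  by (auto simp: difference_def elim!: degree_eq_zeroE)

text \<open>Shifting the argument preserves the leading coefficient, which therefore
  cancels.\<close>

lemma degree_difference_less:
  assumes "degree q > 0"
  shows "degree (difference q) < degree q"
proof -
  have d: "degree (pcompose q [:1, 1:]) = degree q"
    by (simp add: degree_pcompose)
  have "coeff (pcompose q [:1, 1:]) (degree q) = lead_coeff q"
    using lead_coeff_comp[of "[:1, 1 :: rat:]" q] by (simp add: d)
  then have "coeff (difference q) (degree q) = 0"
    by (simp add: difference_def)
  moreover have "degree (difference q) \<le> degree q"
    unfolding difference_def by (intro degree_diff_le) (simp_all add: d)
  ultimately show ?thesis
    using eq_zero_or_degree_less assms by fastforce
qed

text \<open>\<open>poly_shift 1\<close> drops the constant term and divides by the variable; this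
  supplies the factor \<open>r\<close> in boundary terms.\<close>

lemma poly_minus_poly_0:
  fixes q :: "'a :: comm_ring_1 poly"
  shows "poly q x - poly q 0 = x * poly (poly_shift 1 q) x"
proof -
  obtain a p where q: "q = pCons a p" by (cases q)
  have "poly_shift 1 q = p"
    by (rule poly_eqI) (simp add: coeff_poly_shift q)
  then show ?thesis by (simp add: q)
qed

text \<open>Faulhaber's formula: an antidifference \<open>R\<close> telescopes the sum to its value
  at \<open>r\<close> minus its value at 0, which is divisible by \<open>r\<close>.\<close>

lemma sum_poly_eq_mult:
  fixes q :: "rat poly"
  shows "\<exists>p :: rat poly. \<forall>r. (\<Sum>x<r. poly q (of_nat x)) = of_nat r * poly p (of_nat r)"
proof -
  obtain Q :: "nat \<Rightarrow> rat poly" where Q: "\<And>i x. poly (Q i) (x + 1) - poly (Q i) x = x ^ i"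
    using power_antidifference by metis
  define R where "R = (\<Sum>i\<le>degree q. smult (coeff q i) (Q i))"
  have R: "poly R (x + 1) - poly R x = poly q x" for x
    by (simp add: R_def poly_sum poly_altdef[of q] sum_subtractf[symmetric]
        right_diff_distrib[symmetric] Q)
  have "(\<Sum>x<r. poly q (of_nat x)) = poly R (of_nat r) - poly R 0" for r
    by (induction r) (simp_all add: R[symmetric] add.commute)
  then show ?thesis by (auto simp: poly_minus_poly_0)
qed

text \<open>Summation by parts with \<open>z = \<zeta> u / \<zeta> w\<close>: the sum for
  \<open>q\<close>, times \<open>1 - z\<close>, is \<open>z\<close> times the sum for
  \<open>difference q\<close> minus the boundary term \<open>poly q r - poly q 0\<close>. The degree
  drops, and the boundary term carries the required factor \<open>r\<close>.\<close>

lemma unity_root_sum_distinct: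
  assumes "u \<in> W" "w \<in> W" "\<kappa> u = \<kappa> w"
  shows "\<exists>F\<in>root_fun \<kappa> W. \<forall>r>0. \<forall>\<zeta>\<in>W \<rightarrow> unity_roots r. \<zeta> u \<noteq> \<zeta> w \<longrightarrow>
    (\<Sum>x<r. of_rat (poly q (of_nat x)) * (\<zeta> u / \<zeta> w) ^ x) = of_nat r * F r \<zeta>"
proof (induction "degree q" arbitrary: q rule: less_induct)
  case less
  have "\<exists>G\<in>root_fun \<kappa> W. \<forall>r>0. \<forall>\<zeta>\<in>W \<rightarrow> unity_roots r. \<zeta> u \<noteq> \<zeta> w \<longrightarrow>
    (\<Sum>x<r. of_rat (poly (difference q) (of_nat x)) * (\<zeta> u / \<zeta> w) ^ x) = of_nat r * G r \<zeta>"
  proof (cases "degree q = 0")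
    case True
    then show ?thesis
      by (intro bexI[OF _ root_fun_of_int[of 0]]) (simp add: difference_eq_0)
  next
    case False
    then show ?thesis by (intro less degree_difference_less) simp
  qed
  then obtain G where G: "G \<in> root_fun \<kappa> W" and G_sum:
    "\<And>r \<zeta>. r > 0 \<Longrightarrow> \<zeta> \<in> W \<rightarrow> unity_roots r \<Longrightarrow> \<zeta> u \<noteq> \<zeta> w \<Longrightarrow>
      (\<Sum>x<r. of_rat (poly (difference q) (of_nat x)) * (\<zeta> u / \<zeta> w) ^ x) = of_nat r * G r \<zeta>"
    by blast
  \<comment> \<open>The quotient \<open>z / (1 - z)\<close> is written as
    \<open>inverse (1 - z) - 1\<close>, so that only generators of \<open>root_fun\<close>
    occur.\<close>
  define F where "F r \<zeta> = (inverse (1 - \<zeta> u / \<zeta> w) - 1) * G r \<zeta> -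
    inverse (1 - \<zeta> u / \<zeta> w) * of_rat (poly (poly_shift 1 q) (of_nat r))" for r \<zeta>
  have "F \<in> root_fun \<kappa> W"
    unfolding F_def
    by (intro root_fun_diff root_fun.mult root_fun.inv root_fun.coeff root_fun_1 G assms)
  moreover have "(\<Sum>x<r. of_rat (poly q (of_nat x)) * (\<zeta> u / \<zeta> w) ^ x) = of_nat r * F r \<zeta>"
    if r: "r > 0" "\<zeta> \<in> W \<rightarrow> unity_roots r" "\<zeta> u \<noteq> \<zeta> w" for r \<zeta>
  proof -
    define z where "z = \<zeta> u / \<zeta> w"
    have uw: "\<zeta> u \<in> unity_roots r" "\<zeta> w \<in> unity_roots r" using r assms by auto
    then have z: "z ^ r = 1" "z \<noteq> 1"
      using r by (auto simp: z_def power_divide)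
    define A where "A q = (\<Sum>x<r. of_rat (poly q (of_nat x)) * z ^ x)" for q
    let ?a = "\<lambda>x. of_rat (poly q (of_nat x)) * z ^ x"
    have "(\<Sum>x<r. ?a (Suc x)) = A q + (of_rat (poly q (of_nat r)) - of_rat (poly q 0))"
      unfolding A_def using sum.lessThan_Suc[of ?a r] sum.lessThan_Suc_shift[of ?a r] z
      by (simp add: algebra_simps)
    also have "of_rat (poly q (of_nat r)) - of_rat (poly q 0) =
        of_nat r * of_rat (poly (poly_shift 1 q) (of_nat r))"
      by (simp add: of_rat_diff[symmetric] poly_minus_poly_0 of_rat_mult)
    also have "(\<Sum>x<r. ?a (Suc x)) = z * (A q + A (difference q))"
      by (simp add: A_def poly_difference of_rat_diff sum_distrib_left sum.distrib[symmetric]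
          algebra_simps)
    finally have "(1 - z) * A q = z * (of_nat r * G r \<zeta>) -
        of_nat r * of_rat (poly (poly_shift 1 q) (of_nat r))"
      using G_sum[OF r] by (simp add: A_def z_def algebra_simps)
    moreover have nz: "1 - z \<noteq> 0" using z by simp
    ultimately have "A q = inverse (1 - z) * (z * (of_nat r * G r \<zeta>) -
        of_nat r * of_rat (poly (poly_shift 1 q) (of_nat r)))"
      by (simp add: field_simps)
    moreover have "inverse (1 - z) - 1 = inverse (1 - z) * z"
      using nz by (simp add: field_simps)
    ultimately have "A q = of_nat r * F r \<zeta>"
      unfolding F_def z_def[symmetric] by (simp add: right_diff_distrib mult_ac)
    then show ?thesis by (simp add: A_def z_def)
  qed
  ultimately show ?case by blast
qed

text \<open>For equal roots the powers are 1 and Faulhaber's formula applies; indicators join this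
  case with that of distinct roots.\<close>

lemma unity_root_sum:
  assumes "u \<in> W" "w \<in> W" "\<kappa> u = \<kappa> w"
  shows "\<exists>F\<in>root_fun \<kappa> W. \<forall>r>0. \<forall>\<zeta>\<in>W \<rightarrow> unity_roots r.
    (\<Sum>x<r. of_rat (poly q (of_nat x)) * (\<zeta> u / \<zeta> w) ^ x) = of_nat r * F r \<zeta>"
proof -
  obtain G where G: "G \<in> root_fun \<kappa> W" and G_sum:
    "\<And>r \<zeta>. r > 0 \<Longrightarrow> \<zeta> \<in> W \<rightarrow> unity_roots r \<Longrightarrow> \<zeta> u \<noteq> \<zeta> w \<Longrightarrow>
      (\<Sum>x<r. of_rat (poly q (of_nat x)) * (\<zeta> u / \<zeta> w) ^ x) = of_nat r * G r \<zeta>"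
    using unity_root_sum_distinct[OF assms, of q] by blast
  obtain p :: "rat poly" where p: "\<And>r. (\<Sum>x<r. poly q (of_nat x)) = of_nat r * poly p (of_nat r)"
    using sum_poly_eq_mult by blast
  have p': "(\<Sum>x<r. of_rat (poly q (of_nat x))) = (of_nat r * of_rat (poly p (of_nat r)) :: complex)"
    for r
    using arg_cong[OF p[of r], of "of_rat :: rat \<Rightarrow> complex"] by (simp add: of_rat_mult of_rat_sum)
  define F where "F r \<zeta> = of_bool (\<zeta> u = \<zeta> w) * of_rat (poly p (of_nat r)) +
    (1 - of_bool (\<zeta> u = \<zeta> w)) * G r \<zeta>" for r \<zeta>
  have "F \<in> root_fun \<kappa> W"
    unfolding F_def
    by (intro root_fun.add root_fun_diff root_fun.mult root_fun.ind root_fun.coeff root_fun_1 G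
        assms)
  moreover have "(\<Sum>x<r. of_rat (poly q (of_nat x)) * (\<zeta> u / \<zeta> w) ^ x) = of_nat r * F r \<zeta>"
    if r: "r > 0" "\<zeta> \<in> W \<rightarrow> unity_roots r" for r \<zeta>
  proof (cases "\<zeta> u = \<zeta> w")
    case True
    have "\<zeta> w \<in> unity_roots r" using r assms by auto
    then have "\<zeta> w \<noteq> 0" using unity_roots_nonzero r by blast
    then show ?thesis using True by (simp add: F_def p')
  next
    case False
    then show ?thesis using G_sum[OF r] by (simp add: F_def)
  qed
  ultimately show ?thesis by blast
qed

section \<open>Flows, components and Betti number of a multigraph with varying edge set\<close>

locale multigraph =
  fixes V :: "'v set" and s t :: "'e \<Rightarrow> 'v"
  assumes finite_V: "finite V"
begin

definition incidence :: "'e \<Rightarrow> 'v \<Rightarrow> int" where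
  "incidence e v = of_bool (t e = v) - of_bool (s e = v)"

definition net :: "'e set \<Rightarrow> ('e \<Rightarrow> int) \<Rightarrow> 'v \<Rightarrow> int" where
  "net E x v = (\<Sum>e\<in>E. x e * incidence e v)"

definition flows :: "'e set \<Rightarrow> ('v \<Rightarrow> int) \<Rightarrow> nat \<Rightarrow> ('e \<Rightarrow> int) set" where
  "flows E b r = {x \<in> E \<rightarrow>\<^sub>E {0..<int r}. \<forall>v\<in>V. [net E x v = b v] (mod int r)}"

definition flow_sum :: "'e set \<Rightarrow> ('e \<Rightarrow> rat poly) \<Rightarrow> ('v \<Rightarrow> int) \<Rightarrow> nat \<Rightarrow> rat" where
  "flow_sum E q b r = (\<Sum>x\<in>flows E b r. \<Prod>e\<in>E. poly (q e) (of_int (x e)))"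

definition subgraph :: "'e set \<Rightarrow> bool" where
  "subgraph E \<longleftrightarrow> finite E \<and> s ` E \<subseteq> V \<and> t ` E \<subseteq> V"

definition conn :: "'e set \<Rightarrow> ('v \<times> 'v) set" where
  "conn E = ((\<lambda>e. (s e, t e)) ` E \<union> (\<lambda>e. (t e, s e)) ` E)\<^sup>*"

definition component :: "'e set \<Rightarrow> 'v \<Rightarrow> 'v set" where
  "component E v = conn E `` {v}"

text \<open>The first Betti number. Only components of elements of \<open>V\<close> are counted, as
  \<open>conn\<close> is a relation on the whole vertex type.\<close>

definition cyclomatic :: "'e set \<Rightarrow> int" where
  "cyclomatic E = int (card E) - int (card V) + int (card (component E ` V))"

lemma subgraph_subset: "subgraph E \<Longrightarrow> E' \<subseteq> E \<Longrightarrow> subgraph E'"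
  unfolding subgraph_def by (auto intro: finite_subset)

lemma sym_conn: "sym (conn E)"
proof -
  have "sym ((\<lambda>e. (s e, t e)) ` E \<union> (\<lambda>e. (t e, s e)) ` E)"
    by (rule symI) auto
  then show ?thesis
    unfolding conn_def by (rule sym_rtrancl)
qed

lemma equiv_conn: "equiv UNIV (conn E)"
  by (intro equivI sym_conn) (auto simp: conn_def refl_rtrancl trans_rtrancl)

lemma component_eq_iff: "component E u = component E v \<longleftrightarrow> (u, v) \<in> conn E"
  unfolding component_def using eq_equiv_class_iff[OF equiv_conn] by blast

lemma edge_in_conn: "e \<in> E \<Longrightarrow> (s e, t e) \<in> conn E"
  unfolding conn_def by auto

lemma conn_mono: "E \<subseteq> E' \<Longrightarrow> conn E \<subseteq> conn E'"
  unfolding conn_def by (intro rtrancl_mono) auto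

lemma net_upd:
  assumes "finite E" "e \<in> E"
  shows "net E (x(e := k)) v = net (E - {e}) x v + k * incidence e v"
  unfolding net_def by (subst sum.remove[OF assms]) (auto intro: sum.cong)

lemma net_remove:
  assumes "finite E" "e \<in> E"
  shows "net E x v = net (E - {e}) x v + x e * incidence e v"
  using net_upd[OF assms, of x "x e"] by simp

lemma net_cong: "(\<And>e. e \<in> E \<Longrightarrow> x e = y e) \<Longrightarrow> net E x = net E y"
  unfolding net_def by (intro ext sum.cong) auto

lemma net_increment:
  assumes "finite E" "e \<in> E"
  shows "net E (x(e := x e + 1)) = (\<lambda>v. net E x v + incidence e v)"
  unfolding net_upd[OF assms] net_remove[OF assms, of x] by (simp add: algebra_simps)

lemma net_add: "net E (\<lambda>e. x e + y e) v = net E x v + net E y v"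
  unfolding net_def by (simp add: distrib_right sum.distrib)

lemma net_mult: "net E (\<lambda>e. c * x e) v = c * net E x v"
  unfolding net_def by (simp add: mult_ac sum_distrib_left)

section \<open>Fourier inversion for demand zero\<close>

lemma prod_power_int_incidence:
  assumes "s e \<in> V" "t e \<in> V" "\<And>v. v \<in> V \<Longrightarrow> \<zeta> v \<noteq> (0 :: complex)"
  shows "(\<Prod>v\<in>V. \<zeta> v powi (k * incidence e v)) = (\<zeta> (t e) / \<zeta> (s e)) powi k"
proof -
  \<comment> \<open>Target and source are separated into numerator and denominator, which covers a
    loop as well: there the two cancel.\<close>
  have "(\<Prod>v\<in>V. \<zeta> v powi (k * incidence e v)) =
      (\<Prod>v\<in>V. (if v = t e then \<zeta> v powi k else 1) / (if v = s e then \<zeta> v powi k else 1))"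
    by (intro prod.cong refl) (use assms in \<open>auto simp: incidence_def power_int_minus field_simps\<close>)
  also have "\<dots> = \<zeta> (t e) powi k / \<zeta> (s e) powi k"
    using assms finite_V by (simp add: prod_dividef prod.delta)
  finally show ?thesis by (simp add: power_int_divide_distrib)
qed

text \<open>The congruence at each vertex is detected by orthogonality, with one root of unity
  \<open>\<zeta> v\<close> per vertex. After the sums are exchanged, the exponents are regrouped by
  edges and the sum over \<open>x\<close> factorises.\<close>

lemma flow_sum_0_fourier:
  assumes E: "subgraph E" and r: "r > 0"
  shows "of_nat r ^ card V * of_rat (flow_sum E q (\<lambda>_. 0) r) = (\<Sum>\<zeta>\<in>V \<rightarrow>\<^sub>E unity_roots r.
    \<Prod>e\<in>E. \<Sum>x<r. of_rat (poly (q e) (of_nat x)) * (\<zeta> (t e) / \<zeta> (s e)) ^ x)"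
proof -
  have finE: "finite E" using E by (simp add: subgraph_def)
  let ?X = "E \<rightarrow>\<^sub>E {0..<int r}"
  let ?Q = "\<lambda>x. \<Prod>e\<in>E. of_rat (poly (q e) (of_int (x e))) :: complex"
  have finX: "finite ?X" by (intro finite_PiE finE) auto
  have fin_roots: "finite (unity_roots r)" using r by (intro finite_roots_unity) auto
  have nz: "\<zeta> v \<noteq> 0" if "\<zeta> \<in> V \<rightarrow>\<^sub>E unity_roots r" "v \<in> V" for \<zeta> v
    using that unity_roots_nonzero[OF r] by (auto simp: PiE_iff)
  have ind: "(\<Sum>\<zeta>\<in>V \<rightarrow>\<^sub>E unity_roots r. \<Prod>v\<in>V. \<zeta> v powi net E x v) =
      (if x \<in> flows E (\<lambda>_. 0) r then of_nat r ^ card V else 0)" if "x \<in> ?X" for x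
  proof -
    have "(\<Sum>\<zeta>\<in>V \<rightarrow>\<^sub>E unity_roots r. \<Prod>v\<in>V. \<zeta> v powi net E x v) =
        (\<Prod>v\<in>V. \<Sum>z\<in>unity_roots r. z powi net E x v)"
      by (rule prod_sum_PiE[symmetric]) (use finite_V fin_roots in auto)
    also have "\<dots> = (\<Prod>v\<in>V. if int r dvd net E x v then of_nat r else 0)"
      by (simp only: sum_unity_roots_power_int[OF r])
    also have "\<dots> = (if \<forall>v\<in>V. int r dvd net E x v then of_nat r ^ card V else 0)"
      using finite_V by (auto simp: prod_zero_iff)
    finally show ?thesis
      using that by (simp add: flows_def cong_0_iff)
  qed
  have "of_nat r ^ card V * of_rat (flow_sum E q (\<lambda>_. 0) r) =
      (\<Sum>x\<in>flows E (\<lambda>_. 0) r. of_nat r ^ card V * ?Q x)"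
    by (simp add: flow_sum_def of_rat_sum of_rat_prod sum_distrib_left)
  also have "\<dots> = (\<Sum>x\<in>?X. if x \<in> flows E (\<lambda>_. 0) r then of_nat r ^ card V * ?Q x else 0)"
    using sum.inter_restrict[OF finX, of _ "flows E (\<lambda>_. 0) r"]
    by (simp add: flows_def Int_def conj_ac cong: conj_cong)
  also have "\<dots> = (\<Sum>x\<in>?X. \<Sum>\<zeta>\<in>V \<rightarrow>\<^sub>E unity_roots r. ?Q x * (\<Prod>v\<in>V. \<zeta> v powi net E x v))"
    by (intro sum.cong refl) (simp only: sum_distrib_left[symmetric] ind, simp)
  also have "\<dots> = (\<Sum>\<zeta>\<in>V \<rightarrow>\<^sub>E unity_roots r. \<Sum>x\<in>?X. ?Q x * (\<Prod>v\<in>V. \<zeta> v powi net E x v))"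
    by (rule sum.swap)
  also have "\<dots> = (\<Sum>\<zeta>\<in>V \<rightarrow>\<^sub>E unity_roots r.
    \<Prod>e\<in>E. \<Sum>x<r. of_rat (poly (q e) (of_nat x)) * (\<zeta> (t e) / \<zeta> (s e)) ^ x)"
  proof (intro sum.cong refl)
    fix \<zeta> assume \<zeta>: "\<zeta> \<in> V \<rightarrow>\<^sub>E unity_roots r"
    have "(\<Prod>v\<in>V. \<zeta> v powi net E x v) = (\<Prod>e\<in>E. (\<zeta> (t e) / \<zeta> (s e)) powi x e)" for x
    proof -
      have "\<zeta> v powi net E x v = (\<Prod>e\<in>E. \<zeta> v powi (x e * incidence e v))" if "v \<in> V" for v
        unfolding net_def using finE
        by induction (use nz[OF \<zeta> that] in \<open>simp_all add: power_int_add\<close>)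
      then have "(\<Prod>v\<in>V. \<zeta> v powi net E x v) =
          (\<Prod>e\<in>E. \<Prod>v\<in>V. \<zeta> v powi (x e * incidence e v))"
        by (subst prod.swap) simp
      also have "\<dots> = (\<Prod>e\<in>E. (\<zeta> (t e) / \<zeta> (s e)) powi x e)"
        by (intro prod.cong refl prod_power_int_incidence)
          (use E nz[OF \<zeta>] in \<open>auto simp: subgraph_def\<close>)
      finally show ?thesis .
    qed
    then have "(\<Sum>x\<in>?X. ?Q x * (\<Prod>v\<in>V. \<zeta> v powi net E x v)) =
        (\<Sum>x\<in>?X. \<Prod>e\<in>E. of_rat (poly (q e) (of_int (x e))) * (\<zeta> (t e) / \<zeta> (s e)) powi x e)"
      by (simp add: prod.distrib)
    also have "\<dots> = (\<Prod>e\<in>E. \<Sum>k\<in>{0..<int r}.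
        of_rat (poly (q e) (of_int k)) * (\<zeta> (t e) / \<zeta> (s e)) powi k)"
      by (rule prod_sum_PiE[symmetric]) (use finE in auto)
    also have "\<dots> = (\<Prod>e\<in>E. \<Sum>x<r. of_rat (poly (q e) (of_nat x)) * (\<zeta> (t e) / \<zeta> (s e)) ^ x)"
    proof (intro prod.cong refl)
      fix e
      show "(\<Sum>k\<in>{0..<int r}. of_rat (poly (q e) (of_int k)) * (\<zeta> (t e) / \<zeta> (s e)) powi k) =
          (\<Sum>x<r. of_rat (poly (q e) (of_nat x)) * (\<zeta> (t e) / \<zeta> (s e)) ^ x)"
        by (rule sum.reindex_bij_witness[of _ int nat]) (auto simp: power_int_def)
    qed
    finally show "(\<Sum>x\<in>?X. ?Q x * (\<Prod>v\<in>V. \<zeta> v powi net E x v)) =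
        (\<Prod>e\<in>E. \<Sum>x<r. of_rat (poly (q e) (of_nat x)) * (\<zeta> (t e) / \<zeta> (s e)) ^ x)" .
  qed
  finally show ?thesis .
qed

text \<open>Each edge contributes a factor \<open>r\<close>, and the sum over \<open>\<zeta>\<close>
  one for each component, while Fourier inversion divides by \<open>r\<close> for each vertex: the
  exponent is the Betti number. The ends of an edge share a component, so \<open>component E\<close>
  can serve as \<open>\<kappa>\<close>.\<close>

lemma flow_sum_0_polynomial:
  assumes E: "subgraph E"
  shows "\<exists>p. \<forall>r>0. flow_sum E q (\<lambda>_. 0) r = of_nat r powi cyclomatic E * poly p (of_nat r)"
proof -
  have "\<forall>e\<in>E. \<exists>F\<in>root_fun (component E) V. \<forall>r>0. \<forall>\<zeta>\<in>V \<rightarrow> unity_roots r.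
    (\<Sum>x<r. of_rat (poly (q e) (of_nat x)) * (\<zeta> (t e) / \<zeta> (s e)) ^ x) = of_nat r * F r \<zeta>"
    by (intro ballI unity_root_sum)
      (use E edge_in_conn symD[OF sym_conn] component_eq_iff in \<open>auto simp: subgraph_def\<close>)
  then have "\<exists>F. \<forall>e\<in>E. F e \<in> root_fun (component E) V \<and> (\<forall>r>0. \<forall>\<zeta>\<in>V \<rightarrow> unity_roots r.
    (\<Sum>x<r. of_rat (poly (q e) (of_nat x)) * (\<zeta> (t e) / \<zeta> (s e)) ^ x) = of_nat r * F e r \<zeta>)"
    unfolding Bex_def by (rule bchoice)
  then obtain F where F': "\<forall>e\<in>E. F e \<in> root_fun (component E) V \<and> (\<forall>r>0. \<forall>\<zeta>\<in>V \<rightarrow> unity_roots r.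
    (\<Sum>x<r. of_rat (poly (q e) (of_nat x)) * (\<zeta> (t e) / \<zeta> (s e)) ^ x) = of_nat r * F e r \<zeta>)" ..
  have F: "F e \<in> root_fun (component E) V" if "e \<in> E" for e
    using F' that by blast
  have F_sum: "(\<Sum>x<r. of_rat (poly (q e) (of_nat x)) * (\<zeta> (t e) / \<zeta> (s e)) ^ x) =
      of_nat r * F e r \<zeta>" if "e \<in> E" "r > 0" "\<zeta> \<in> V \<rightarrow> unity_roots r" for e r \<zeta>
    using F' that by blast
  obtain p :: "rat poly" where
    p: "\<And>r. r > 0 \<Longrightarrow> (\<Sum>\<zeta>\<in>V \<rightarrow>\<^sub>E unity_roots r. \<Prod>e\<in>E. F e r \<zeta>) =
      of_nat r ^ card (component E ` V) * of_rat (poly p (of_nat r))"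
    using root_fun_sum_polynomial[OF finite_V root_fun_prod[of E F, OF F]] by blast
  have "flow_sum E q (\<lambda>_. 0) r = of_nat r powi cyclomatic E * poly p (of_nat r)"
    if r: "r > 0" for r
  proof -
    have "of_nat r ^ card V * of_rat (flow_sum E q (\<lambda>_. 0) r) =
        (\<Sum>\<zeta>\<in>V \<rightarrow>\<^sub>E unity_roots r. \<Prod>e\<in>E. of_nat r * F e r \<zeta>)"
      unfolding flow_sum_0_fourier[OF E r]
      by (intro sum.cong prod.cong refl F_sum r) (auto simp: PiE_def)
    also have "\<dots> = of_nat r ^ card E * (of_nat r ^ card (component E ` V) *
        of_rat (poly p (of_nat r)))"
      by (simp add: prod.distrib sum_distrib_left[symmetric] p[OF r])
    finally have "(of_rat (of_nat r ^ card V * flow_sum E q (\<lambda>_. 0) r) :: complex) =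
        of_rat (of_nat r ^ card E * (of_nat r ^ card (component E ` V) * poly p (of_nat r)))"
      by (simp add: of_rat_mult of_rat_power)
    then have "of_nat r ^ card V * flow_sum E q (\<lambda>_. 0) r =
        of_nat r ^ card E * (of_nat r ^ card (component E ` V) * poly p (of_nat r))"
      by (simp only: of_rat_eq_iff)
    moreover have "(of_nat r :: rat) powi cyclomatic E * of_nat r ^ card V =
        of_nat r ^ card E * of_nat r ^ card (component E ` V)"
      unfolding cyclomatic_def using r
      by (simp add: power_int_add power_int_diff)
    ultimately have "of_nat r ^ card V * flow_sum E q (\<lambda>_. 0) r =
        of_nat r ^ card V * (of_nat r powi cyclomatic E * poly p (of_nat r))"
      by (simp add: mult_ac)
    then show ?thesis using r by simp
  qed
  then show ?thesis by blast
qed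

section \<open>Recursion in the value at one edge\<close>

lemma flows_upd_iff:
  assumes "finite E" "e \<in> E" and y: "y \<in> (E - {e}) \<rightarrow>\<^sub>E {0..<int r}" and k: "0 \<le> k" "k < int r"
  shows "y(e := k) \<in> flows E b r \<longleftrightarrow> y \<in> flows (E - {e}) (\<lambda>v. b v - k * incidence e v) r"
proof -
  have "y(e := k) \<in> E \<rightarrow>\<^sub>E {0..<int r}"
    using assms by (auto simp: PiE_iff extensional_def)
  moreover have "[net E (y(e := k)) v = b v] (mod int r) \<longleftrightarrow>
      [net (E - {e}) y v = b v - k * incidence e v] (mod int r)" for v
    unfolding net_upd[OF assms(1,2)] cong_iff_dvd_diff by (simp add: algebra_simps)
  ultimately show ?thesis using y by (simp add: flows_def)
qed

lemma flows_cong: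
  assumes "\<And>v. v \<in> V \<Longrightarrow> [b v = b' v] (mod int r)"
  shows "flows E b r = flows E b' r"
  using assms unfolding flows_def by (meson cong_trans cong_sym)

lemma flow_sum_fibres:
  assumes E: "finite E" "e \<in> E"
  shows "flow_sum E q b r = (\<Sum>k\<in>{0..<int r}. poly (q e) (of_int k) *
    flow_sum (E - {e}) q (\<lambda>v. b v - k * incidence e v) r)"
proof -
  let ?Q = "\<lambda>x. \<Prod>f\<in>E. poly (q f) (of_int (x f))"
  let ?Q' = "\<lambda>x. \<Prod>f\<in>E - {e}. poly (q f) (of_int (x f))"
  let ?Y = "(E - {e}) \<rightarrow>\<^sub>E {0..<int r}"
  have fin: "finite (E \<rightarrow>\<^sub>E {0..<int r})" "finite ?Y" by (intro finite_PiE; use E in simp)+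
  have E': "insert e (E - {e}) = E" using E by auto
  have "flow_sum E q b r = (\<Sum>x\<in>insert e (E - {e}) \<rightarrow>\<^sub>E {0..<int r}. if x \<in> flows E b r then ?Q x else 0)"
    unfolding flow_sum_def E' using sum.inter_restrict[OF fin(1), of _ "flows E b r"]
    by (simp add: flows_def Int_def conj_ac cong: conj_cong)
  also have "\<dots> = (\<Sum>y\<in>?Y. \<Sum>k\<in>{0..<int r}. if y(e := k) \<in> flows E b r then ?Q (y(e := k)) else 0)"
    by (rule sum_PiE_insert) simp
  also have "\<dots> = (\<Sum>k\<in>{0..<int r}. \<Sum>y\<in>?Y. if y(e := k) \<in> flows E b r then ?Q (y(e := k)) else 0)"
    by (rule sum.swap)
  also have "\<dots> = (\<Sum>k\<in>{0..<int r}. \<Sum>y\<in>?Y. if y \<in> flows (E - {e}) (\<lambda>v. b v - k * incidence e v) r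
      then poly (q e) (of_int k) * ?Q' y else 0)"
  proof (intro sum.cong refl)
    fix k y assume ky: "k \<in> {0..<int r}" "y \<in> ?Y"
    have "?Q (y(e := k)) = poly (q e) (of_int k) * ?Q' y"
      by (subst prod.remove[OF E]) (auto intro: prod.cong)
    moreover have "y(e := k) \<in> flows E b r \<longleftrightarrow>
        y \<in> flows (E - {e}) (\<lambda>v. b v - k * incidence e v) r"
      by (rule flows_upd_iff[OF E ky(2)]) (use ky in auto)
    ultimately show "(if y(e := k) \<in> flows E b r then ?Q (y(e := k)) else 0) =
      (if y \<in> flows (E - {e}) (\<lambda>v. b v - k * incidence e v) r
        then poly (q e) (of_int k) * ?Q' y else 0)"
      by (simp only:)
  qed
  also have "\<dots> = (\<Sum>k\<in>{0..<int r}. poly (q e) (of_int k) *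
      flow_sum (E - {e}) q (\<lambda>v. b v - k * incidence e v) r)"
  proof (intro sum.cong refl)
    fix k
    have Y: "?Y \<inter> flows (E - {e}) b r = flows (E - {e}) b r" for b
      by (auto simp: flows_def)
    let ?b = "\<lambda>v. b v - k * incidence e v"
    have "(\<Sum>y\<in>?Y. if y \<in> flows (E - {e}) ?b r then poly (q e) (of_int k) * ?Q' y else 0) =
        (\<Sum>y\<in>flows (E - {e}) ?b r. poly (q e) (of_int k) * ?Q' y)"
      by (subst Y[symmetric], rule sum.inter_restrict[OF fin(2), symmetric])
    then show "(\<Sum>y\<in>?Y. if y \<in> flows (E - {e}) ?b r then poly (q e) (of_int k) * ?Q' y else 0) =
        poly (q e) (of_int k) * flow_sum (E - {e}) q ?b r"
      by (simp add: flow_sum_def sum_distrib_left)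
  qed
  finally show ?thesis .
qed

lemma flow_sum_cong_mod:
  assumes "\<And>v. v \<in> V \<Longrightarrow> [b v = b' v] (mod int r)"
  shows "flow_sum E q b r = flow_sum E q b' r"
  unfolding flow_sum_def using flows_cong[OF assms] by simp

lemma flow_sum_cong_weight:
  assumes "\<And>e. e \<in> E \<Longrightarrow> q e = q' e"
  shows "flow_sum E q b r = flow_sum E q' b r"
  unfolding flow_sum_def using assms by simp

text \<open>On the other edges, value \<open>k + 1\<close> at \<open>e\<close> with the raised
  demand leaves the same task as value \<open>k\<close> with the old demand. Re-indexing therefore
  replaces \<open>q e\<close> at \<open>k\<close> by \<open>q e\<close> at \<open>k + 1\<close>, and
  the ends 0 and \<open>r\<close> of the range leave a multiple of \<open>r\<close>.\<close>

lemma flow_sum_shift: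
  assumes E: "finite E" "e \<in> E" and r: "r > 0"
  shows "flow_sum E q (\<lambda>v. b v + incidence e v) r =
    flow_sum E q b r + flow_sum E (q(e := difference (q e))) b r -
    of_nat r * poly (poly_shift 1 (q e)) (of_nat r) *
      flow_sum (E - {e}) q (\<lambda>v. b v + incidence e v) r"
proof -
  let ?b' = "\<lambda>v. b v + incidence e v"
  let ?S = "\<lambda>k. flow_sum (E - {e}) q (\<lambda>v. ?b' v - k * incidence e v) r"
  let ?p = "\<lambda>k. poly (q e) (of_int k)"
  \<comment> \<open>Demands matter only modulo \<open>r\<close>, so the values 0 and
    \<open>r\<close> at \<open>e\<close> lead to the same sum.\<close>
  have "?S (int r) = ?S 0"
    by (rule flow_sum_cong_mod) (simp add: cong_iff_dvd_diff)
  have split: "(\<Sum>k\<in>{0..<int r}. f k) = f 0 + (\<Sum>k\<in>{0..<int r}. f (k + 1)) - f (int r)"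
    for f :: "int \<Rightarrow> rat"
  proof -
    have *: "(\<Sum>k\<in>{0..<int r}. g k) = (\<Sum>x<r. g (int x))" for g :: "int \<Rightarrow> rat"
      by (rule sum.reindex_bij_witness[of _ int nat]) auto
    show ?thesis
      unfolding * using sum.lessThan_Suc[of "\<lambda>x. f (int x)" r]
        sum.lessThan_Suc_shift[of "\<lambda>x. f (int x)" r]
      by (simp add: add.commute)
  qed
  have "flow_sum E q ?b' r = (\<Sum>k\<in>{0..<int r}. ?p k * ?S k)"
    by (rule flow_sum_fibres[OF E])
  also have "\<dots> = ?p 0 * ?S 0 + (\<Sum>k\<in>{0..<int r}. ?p (k + 1) * ?S (k + 1)) - ?p (int r) * ?S (int r)"
    by (rule split)
  also have "\<dots> = (\<Sum>k\<in>{0..<int r}. ?p (k + 1) * ?S (k + 1)) -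
      (poly (q e) (of_nat r) - poly (q e) 0) * ?S 0"
    unfolding \<open>?S (int r) = ?S 0\<close> by (simp add: algebra_simps)
  also have "(\<Sum>k\<in>{0..<int r}. ?p (k + 1) * ?S (k + 1)) =
      (\<Sum>k\<in>{0..<int r}. ?p k * flow_sum (E - {e}) q (\<lambda>v. b v - k * incidence e v) r) +
      (\<Sum>k\<in>{0..<int r}. poly (difference (q e)) (of_int k) *
        flow_sum (E - {e}) q (\<lambda>v. b v - k * incidence e v) r)"
    by (simp add: sum.distrib[symmetric] poly_difference algebra_simps)
  also have "(\<Sum>k\<in>{0..<int r}. ?p k * flow_sum (E - {e}) q (\<lambda>v. b v - k * incidence e v) r) =
      flow_sum E q b r"
    by (rule flow_sum_fibres[OF E, symmetric])
  also have "(\<Sum>k\<in>{0..<int r}. poly (difference (q e)) (of_int k) *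
        flow_sum (E - {e}) q (\<lambda>v. b v - k * incidence e v) r) =
      flow_sum E (q(e := difference (q e))) b r"
    unfolding flow_sum_fibres[OF E, of "q(e := difference (q e))"]
    by (intro sum.cong refl arg_cong2[of _ _ _ _ "(*)"] flow_sum_cong_weight) auto
  finally show ?thesis
    by (simp add: poly_minus_poly_0)
qed

section \<open>Deletion of bridges and of other edges\<close>

lemma net_single_edge:
  assumes "finite E" "e \<in> E"
  shows "net E (\<lambda>f. of_bool (f = e)) v = incidence e v"
  using net_upd[OF assms, of "\<lambda>_. 0" 1 v] net_cong[of E "(\<lambda>_. 0)(e := 1)" "\<lambda>f. of_bool (f = e)"]
  by (simp add: net_def)

text \<open>A unit flow along a path from \<open>u\<close> to \<open>w\<close>: each traversal adds
  1 or -1 at the edge, according to its direction.\<close>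

lemma conn_imp_net:
  assumes "finite E" and "(u, w) \<in> conn E"
  shows "\<exists>m. \<forall>v. net E m v = of_bool (w = v) - of_bool (u = v)"
  using assms(2) unfolding conn_def
proof (induction rule: rtrancl_induct)
  case base
  show ?case by (intro exI[of _ "\<lambda>_. 0"]) (simp add: net_def)
next
  case (step y z)
  then obtain m where m: "\<And>v. net E m v = of_bool (y = v) - of_bool (u = v)" by blast
  from step.hyps(2) obtain e c where e: "e \<in> E"
    "\<And>v. c * incidence e v = of_bool (z = v) - of_bool (y = v)"
  proof
    assume "(y, z) \<in> (\<lambda>e. (s e, t e)) ` E"
    then show thesis using that[of _ 1] by (auto simp: incidence_def)
  next
    assume "(y, z) \<in> (\<lambda>e. (t e, s e)) ` E"
    then show thesis using that[of _ "- 1"] by (auto simp: incidence_def)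
  qed
  have "net E (\<lambda>f. m f + c * of_bool (f = e)) v = of_bool (z = v) - of_bool (u = v)" for v
    unfolding net_add net_mult net_single_edge[OF assms(1) e(1)] m e(2) by simp
  then show ?case by blast
qed

text \<open>The connection relation survives the deletion, so only the number of edges
  changes.\<close>

lemma cyclomatic_remove_nonbridge:
  assumes "finite E" "e \<in> E" and "(s e, t e) \<in> conn (E - {e})"
  shows "cyclomatic (E - {e}) = cyclomatic E - 1"
proof -
  let ?R = "\<lambda>E. (\<lambda>e. (s e, t e)) ` E \<union> (\<lambda>e. (t e, s e)) ` E"
  have "?R E \<subseteq> conn (E - {e})"
  proof
    fix p assume "p \<in> ?R E"
    then obtain f where f: "f \<in> E" "p = (s f, t f) \<or> p = (t f, s f)" by auto
    have "(s f, t f) \<in> conn (E - {e})"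
      using f(1) assms(3) edge_in_conn[of f "E - {e}"] by (cases "f = e") auto
    then show "p \<in> conn (E - {e})"
      using f(2) symD[OF sym_conn] by auto
  qed
  then have "conn E \<subseteq> conn (E - {e})"
    unfolding conn_def by (rule rtrancl_subset_rtrancl)
  then have "conn E = conn (E - {e})"
    using conn_mono[of "E - {e}" E] by auto
  then have "component E = component (E - {e})"
    by (auto simp: component_def)
  then show ?thesis
    using assms(1,2) card_Suc_Diff1[OF assms(1,2)] by (simp add: cyclomatic_def)
qed

text \<open>Every component of \<open>E\<close> is a union of components of \<open>E - {e}\<close>.
  The resulting surjection identifies the components of the two ends of \<open>e\<close>, hence is
  not injective, and the gain in components makes up for the lost edge.\<close>

lemma cyclomatic_remove_bridge:
  assumes E: "subgraph E" "e \<in> E" and "(s e, t e) \<notin> conn (E - {e})"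
  shows "cyclomatic (E - {e}) \<ge> cyclomatic E"
proof -
  let ?E = "E - {e}"
  have eV: "s e \<in> V" "t e \<in> V" and fin: "finite E" using E by (auto simp: subgraph_def)
  have fac: "component E u = conn E `` component ?E u" for u
  proof -
    have "conn ?E O conn E \<subseteq> conn E O conn E"
      using conn_mono[of ?E E] by auto
    also have "\<dots> \<subseteq> conn E"
      using trans_rtrancl unfolding conn_def by (rule trans_O_subset)
    finally have "conn ?E O conn E = conn E"
      by (auto simp: conn_def)
    then show ?thesis by (simp add: component_def relcomp_Image[symmetric])
  qed
  let ?\<phi> = "\<lambda>C. conn E `` C"
  have img: "?\<phi> ` component ?E ` V = component E ` V"
    by (simp add: image_image fac[symmetric])
  have finC: "finite (component ?E ` V)" using finite_V by simp
  have "\<not> inj_on ?\<phi> (component ?E ` V)"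
  proof
    assume inj: "inj_on ?\<phi> (component ?E ` V)"
    have "component E (s e) = component E (t e)"
      using edge_in_conn[OF E(2)] by (simp add: component_eq_iff)
    then have "conn E `` component ?E (s e) = conn E `` component ?E (t e)"
      by (simp only: fac)
    then have "component ?E (s e) = component ?E (t e)"
      by (rule inj_onD[OF inj]) (use eV in auto)
    then show False using assms(3) by (simp add: component_eq_iff)
  qed
  then have "card (component E ` V) < card (component ?E ` V)"
    using card_image_le[OF finC, of ?\<phi>] eq_card_imp_inj_on[OF finC, of ?\<phi>]
    unfolding img by linarith
  then show ?thesis
    using card_Suc_Diff1[OF fin E(2)] by (simp add: cyclomatic_def)
qed

text \<open>The ends of an edge lie both inside or both outside the component, so its contributions
  cancel.\<close>

lemma sum_net_component:
  assumes "subgraph E"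
  shows "(\<Sum>v\<in>V \<inter> component E u. net E x v) = 0"
proof -
  have "(\<Sum>v\<in>V \<inter> component E u. incidence e v) = 0" if "e \<in> E" for e
  proof -
    have "e \<in> E \<Longrightarrow> t e \<in> component E u \<longleftrightarrow> s e \<in> component E u"
      using edge_in_conn[of e E] equiv_conn
      unfolding component_def by (meson Image_singleton_iff equivE symD transD)
    then show ?thesis
      using that assms finite_V
      by (auto simp: incidence_def sum_subtractf subgraph_def of_bool_def sum.delta)
  qed
  then show ?thesis
    unfolding net_def by (subst sum.swap) (simp add: sum_distrib_left[symmetric])
qed

text \<open>Sum the congruences over the side of the bridge containing its target. A flow avoiding
  \<open>e\<close> contributes 0 there, whereas the demand sums to \<open>n e\<close>; so
  \<open>r\<close> would divide \<open>n e\<close>, which is nonzero and smaller than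
  \<open>r\<close> in absolute value.\<close>

lemma bridge_flows_empty:
  assumes E: "subgraph E" "e \<in> E" and bridge: "(s e, t e) \<notin> conn (E - {e})"
    and ne: "n e \<noteq> 0" and r: "int r > \<bar>n e\<bar>"
  shows "flows (E - {e}) (net E n) r = {}"
proof (rule ccontr)
  let ?E = "E - {e}"
  let ?C = "V \<inter> component ?E (t e)"
  assume "flows ?E (net E n) r \<noteq> {}"
  then obtain x where x: "\<And>v. v \<in> V \<Longrightarrow> [net ?E x v = net E n v] (mod int r)"
    by (auto simp: flows_def)
  have sub: "subgraph ?E" and fin: "finite E"
    using E by (auto intro: subgraph_subset simp: subgraph_def)
  have "[(\<Sum>v\<in>?C. net ?E x v) = (\<Sum>v\<in>?C. net E n v)] (mod int r)"
    by (intro cong_sum x) auto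
  also have "(\<Sum>v\<in>?C. net E n v) = (\<Sum>v\<in>?C. net ?E n v) + n e * (\<Sum>v\<in>?C. incidence e v)"
    by (simp add: net_remove[OF fin E(2)] sum.distrib sum_distrib_left)
  also have "(\<Sum>v\<in>?C. incidence e v) = 1"
  proof -
    have "t e \<in> ?C" "s e \<notin> ?C"
      using E bridge symD[OF sym_conn]
      by (auto simp: component_def subgraph_def conn_def)
    then show ?thesis
      using finite_V by (simp add: incidence_def sum_subtractf of_bool_def sum.delta)
  qed
  finally have "int r dvd n e"
    by (simp add: sum_net_component[OF sub] cong_iff_dvd_diff)
  then show False
    using dvd_imp_le_int[OF ne, of "int r"] r by simp
qed

section \<open>Constant terms as functions of the demand\<close>

text \<open>The demand is parametrised as \<open>net E n\<close> with \<open>n\<close> ranging over all integer vectors: these are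
  exactly the demands in the lattice spanned by the edges.\<close>

definition eventually_polynomial :: "'e set \<Rightarrow> (('e \<Rightarrow> int) \<Rightarrow> nat \<Rightarrow> rat) \<Rightarrow> bool" where
  "eventually_polynomial E f \<longleftrightarrow> (\<exists>c :: ('e \<Rightarrow> int) \<Rightarrow> rat poly.
    (\<forall>n. \<forall>\<^sub>F r in sequentially. f n r = of_nat r powi cyclomatic E * poly (c n) (of_nat r)) \<and>
    (\<lambda>n. coeff (c n) 0) \<in> polyfun E)"

lemma eventually_polynomialI:
  assumes "\<And>n. \<forall>\<^sub>F r in sequentially. f n r = of_nat r powi cyclomatic E * poly (c n) (of_nat r)"
    and "(\<lambda>n. coeff (c n) 0) \<in> polyfun E"
  shows "eventually_polynomial E f"
  using assms unfolding eventually_polynomial_def by blast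

lemma eventually_polynomialE:
  assumes "eventually_polynomial E f"
  obtains c where
    "\<And>n. \<forall>\<^sub>F r in sequentially. f n r = of_nat r powi cyclomatic E * poly (c n) (of_nat r)"
    and "(\<lambda>n. coeff (c n) 0) \<in> polyfun E"
  using assms unfolding eventually_polynomial_def by blast

lemma eventually_polynomial_diff:
  assumes "eventually_polynomial E f" "eventually_polynomial E f'"
  shows "eventually_polynomial E (\<lambda>n r. f n r - f' n r)"
proof -
  from assms(1) obtain c where
    c: "\<And>n. \<forall>\<^sub>F r in sequentially. f n r = of_nat r powi cyclomatic E * poly (c n) (of_nat r)"
    "(\<lambda>n. coeff (c n) 0) \<in> polyfun E" by (rule eventually_polynomialE) blast
  from assms(2) obtain c' where
    c': "\<And>n. \<forall>\<^sub>F r in sequentially. f' n r = of_nat r powi cyclomatic E * poly (c' n) (of_nat r)"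
    "(\<lambda>n. coeff (c' n) 0) \<in> polyfun E" by (rule eventually_polynomialE) blast
  show ?thesis
  proof (rule eventually_polynomialI)
    show "\<forall>\<^sub>F r in sequentially. f n r - f' n r =
        of_nat r powi cyclomatic E * poly (c n - c' n) (of_nat r)" for n
      using c(1)[of n] c'(1)[of n] by eventually_elim (simp add: right_diff_distrib)
    show "(\<lambda>n. coeff (c n - c' n) 0) \<in> polyfun E"
      using polyfun_diff[OF c(2) c'(2)] by simp
  qed
qed

lemma eventually_polynomial_mult_poly:
  assumes "eventually_polynomial E f"
  shows "eventually_polynomial E (\<lambda>n r. poly p (of_nat r) * f n r)"
proof -
  from assms obtain c where
    c: "\<And>n. \<forall>\<^sub>F r in sequentially. f n r = of_nat r powi cyclomatic E * poly (c n) (of_nat r)"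
    "(\<lambda>n. coeff (c n) 0) \<in> polyfun E" by (rule eventually_polynomialE) blast
  show ?thesis
  proof (rule eventually_polynomialI)
    show "\<forall>\<^sub>F r in sequentially. poly p (of_nat r) * f n r =
        of_nat r powi cyclomatic E * poly (p * c n) (of_nat r)" for n
      using c(1)[of n] by eventually_elim (simp add: mult_ac)
    show "(\<lambda>n. coeff (p * c n) 0) \<in> polyfun E"
      using polyfun_mult[OF polyfun_const[of "coeff p 0"] c(2)] by (simp add: coeff_mult)
  qed
qed

text \<open>The polynomial at \<open>n = 0\<close> is carried to every \<open>n\<close> by adding or
  subtracting those of the unit steps. The constant terms then have polynomial differences, and
  \<open>polyfun_discrete_integral\<close> applies.\<close>

lemma eventually_polynomial_integral:
  assumes "finite E"
    and dep: "\<And>n n'. (\<And>e. e \<in> E \<Longrightarrow> n e = n' e) \<Longrightarrow> f n = f n'"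
    and step: "\<And>e. e \<in> E \<Longrightarrow> eventually_polynomial E (\<lambda>n r. f (n(e := n e + 1)) r - f n r)"
    and zero: "\<forall>\<^sub>F r in sequentially. f (\<lambda>_. 0) r = of_nat r powi cyclomatic E * poly p (of_nat r)"
  shows "eventually_polynomial E f"
proof -
  let ?P = "\<lambda>n p. \<forall>\<^sub>F r in sequentially. f n r = of_nat r powi cyclomatic E * poly p (of_nat r)"
  have "\<forall>e\<in>E. \<exists>d. (\<forall>n. \<forall>\<^sub>F r in sequentially. f (n(e := n e + 1)) r - f n r =
      of_nat r powi cyclomatic E * poly (d n) (of_nat r)) \<and> (\<lambda>n. coeff (d n) 0) \<in> polyfun E"
    using step unfolding eventually_polynomial_def by blast
  from bchoice[OF this] obtain d where
    d: "\<And>e n. e \<in> E \<Longrightarrow> \<forall>\<^sub>F r in sequentially. f (n(e := n e + 1)) r - f n r =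
      of_nat r powi cyclomatic E * poly (d e n) (of_nat r)"
    and d0: "\<And>e. e \<in> E \<Longrightarrow> (\<lambda>n. coeff (d e n) 0) \<in> polyfun E"
    by blast
  have up: "?P (n(e := n e + 1)) (p + d e n)" if "e \<in> E" "?P n p" for e n p
    using d[OF that(1), of n] that(2) by eventually_elim (simp add: algebra_simps)
  have down: "?P n (p - d e n)" if "e \<in> E" "?P (n(e := n e + 1)) p" for e n p
    using d[OF that(1), of n] that(2) by eventually_elim (simp add: algebra_simps)
  have ex: "\<exists>p. ?P n p" for n
  proof (rule lattice_step_invariant[OF assms(1), of "\<lambda>n. \<exists>p. ?P n p"])
    show "(\<exists>p. ?P n p) \<longleftrightarrow> (\<exists>p. ?P n' p)" if "\<And>e. e \<in> E \<Longrightarrow> n e = n' e" for n n'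
      using dep[OF that] by (simp only:)
    show "(\<exists>p. ?P n p) \<longleftrightarrow> (\<exists>p. ?P (n(e := n e + 1)) p)" if "e \<in> E" for e n
      using up[OF that] down[OF that] by blast
    show "\<exists>p. ?P (\<lambda>_. 0) p"
      using zero by blast
  qed
  \<comment> \<open>Uniqueness turns the relation along a unit step into an identity between the
    chosen polynomials \<open>c\<close>.\<close>
  have unique: "p = p'" if "?P n p" "?P n p'" for n p p'
  proof (rule poly_eqI_eventually)
    show "\<forall>\<^sub>F r in sequentially. poly p (of_nat r) = poly p' (of_nat r)"
      using that eventually_gt_at_top[of 0] by eventually_elim simp
  qed
  define c where "c n = (THE p. ?P n p)" for n
  have c: "?P n (c n)" for n
    unfolding c_def by (rule theI') (use ex unique in blast)
  show ?thesis
  proof (rule eventually_polynomialI[OF c])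
    show "(\<lambda>n. coeff (c n) 0) \<in> polyfun E"
    proof (rule polyfun_discrete_integral[OF assms(1)])
      show "coeff (c n) 0 = coeff (c n') 0" if "\<And>e. e \<in> E \<Longrightarrow> n e = n' e" for n n'
        using dep[OF that] by (simp only: c_def)
      show "(\<lambda>n. coeff (c (n(e := n e + 1))) 0 - coeff (c n) 0) \<in> polyfun E" if "e \<in> E" for e
      proof -
        have "c (n(e := n e + 1)) = c n + d e n" for n
          by (rule unique[OF c up[OF that c]])
        then show ?thesis using d0[OF that] by simp
      qed
    qed
  qed
qed

text \<open>This prepares the last term of \<open>flow_sum_shift\<close>: the factor
  \<open>r\<close> compensates the possible drop of the Betti number when \<open>e\<close> is
  deleted.\<close>

lemma eventually_polynomial_correction:
  assumes E: "subgraph E" "e \<in> E"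
    and IH: "eventually_polynomial (E - {e}) (\<lambda>n. flow_sum (E - {e}) q (net (E - {e}) n))"
  shows "eventually_polynomial E (\<lambda>n r. of_nat r * flow_sum (E - {e}) q (net E n) r)"
proof -
  let ?E = "E - {e}"
  have fin: "finite E" using E by (simp add: subgraph_def)
  from IH obtain c where
    c: "\<And>n. \<forall>\<^sub>F r in sequentially. flow_sum ?E q (net ?E n) r =
      of_nat r powi cyclomatic ?E * poly (c n) (of_nat r)"
    and c0: "(\<lambda>n. coeff (c n) 0) \<in> polyfun ?E"
    by (rule eventually_polynomialE) blast
  show ?thesis
  proof (cases "(s e, t e) \<in> conn ?E")
    case True
    \<comment> \<open>A flow \<open>m\<close> avoiding \<open>e\<close> with the same boundary as
      \<open>e\<close> reroutes the amount \<open>n e\<close>, so that the demand becomes that of a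
      vector on \<open>E - {e}\<close> depending linearly on \<open>n\<close>.\<close>
    then obtain m where m: "\<And>v. net ?E m v = incidence e v"
      using conn_imp_net[of ?E] fin unfolding incidence_def by blast
    let ?n' = "\<lambda>n f. n f + n e * m f"
    have n': "net E n = net ?E (?n' n)" for n
      by (rule ext) (simp only: net_remove[OF fin E(2)] net_add net_mult m)
    show ?thesis
    proof (rule eventually_polynomialI)
      show "\<forall>\<^sub>F r in sequentially. of_nat r * flow_sum ?E q (net E n) r =
          of_nat r powi cyclomatic E * poly (c (?n' n)) (of_nat r)" for n
        using c[of "?n' n"] eventually_gt_at_top[of 0]
      proof eventually_elim
        case (elim r)
        have "(of_nat r :: rat) * of_nat r powi cyclomatic ?E = of_nat r powi cyclomatic E"
          using elim cyclomatic_remove_nonbridge[OF fin E(2) True]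
          by (simp add: power_int_diff)
        then show ?case using elim by (simp add: n' mult.assoc[symmetric])
      qed
      have "(\<lambda>n. of_int (?n' n f)) \<in> polyfun E" if "f \<in> ?E" for f
      proof -
        have "(\<lambda>n. of_int (n f) + of_int (n e) * of_int (m f)) \<in> polyfun E"
          using that E by (intro polyfun_add polyfun_mult polyfun_var polyfun_const) auto
        then show ?thesis by simp
      qed
      then show "(\<lambda>n. coeff (c (?n' n)) 0) \<in> polyfun E"
        by (rule polyfun_subst[OF c0])
    qed
  next
    case False
    \<comment> \<open>The surplus power of \<open>r\<close>: deleting a bridge does not lower the
      Betti number, and the extra factor \<open>r\<close> makes the surplus positive.\<close>
    obtain k :: nat where k: "k > 0" "int k = cyclomatic ?E - cyclomatic E + 1"
      using cyclomatic_remove_bridge[OF E False]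
        zero_le_imp_eq_int[of "cyclomatic ?E - cyclomatic E + 1"] by auto
    \<comment> \<open>For \<open>n e \<noteq> 0\<close> there are no flows once \<open>r\<close> is
      large. For \<open>n e = 0\<close> the positive power of \<open>r\<close> kills the constant
      term, which is thus 0 for all \<open>n\<close> in spite of the case distinction.\<close>
    define d where "d n = (if n e = 0 then monom 1 k * c n else 0)" for n
    show ?thesis
    proof (rule eventually_polynomialI)
      show "\<forall>\<^sub>F r in sequentially. of_nat r * flow_sum ?E q (net E n) r =
          of_nat r powi cyclomatic E * poly (d n) (of_nat r)" for n
      proof (cases "n e = 0")
        case True
        then have "net E n = net ?E n"
          by (intro ext) (simp add: net_remove[OF fin E(2)])
        moreover have "\<forall>\<^sub>F r in sequentially. of_nat r * flow_sum ?E q (net ?E n) r =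
            of_nat r powi cyclomatic E * poly (d n) (of_nat r)"
          using c[of n] eventually_gt_at_top[of 0]
        proof eventually_elim
          case (elim r)
          have "(of_nat r :: rat) * of_nat r powi cyclomatic ?E =
              of_nat r powi cyclomatic E * of_nat r powi int k"
            unfolding k(2) using elim by (simp add: power_int_diff power_int_add)
          then show ?case using elim True by (simp add: d_def poly_monom mult.assoc[symmetric])
        qed
        ultimately show ?thesis by simp
      next
        case ne: False
        show ?thesis
          using eventually_gt_at_top[of "nat \<bar>n e\<bar>"]
        proof eventually_elim
          case (elim r)
          then show ?case
            using bridge_flows_empty[of E e n r, OF E False ne]
            by (simp add: flow_sum_def d_def ne nat_less_iff)
        qed
      qed
      have "coeff (d n) 0 = 0" for n
        using k(1) by (simp add: d_def coeff_mult)
      then show "(\<lambda>n. coeff (d n) 0) \<in> polyfun E"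
        by (simp add: polyfun_const)
    qed
  qed
qed

lemma eventually_polynomial_shift:
  assumes "e \<in> E" and "eventually_polynomial E f"
  shows "eventually_polynomial E (\<lambda>n. f (n(e := n e + 1)))"
proof -
  from assms(2) obtain c where
    c: "\<And>n. \<forall>\<^sub>F r in sequentially. f n r = of_nat r powi cyclomatic E * poly (c n) (of_nat r)"
    "(\<lambda>n. coeff (c n) 0) \<in> polyfun E" by (rule eventually_polynomialE) blast
  have "(\<lambda>n. of_int ((n(e := n e + 1)) f)) \<in> polyfun E" if "f \<in> E" for f
  proof -
    have "(\<lambda>n :: 'e \<Rightarrow> int. rat_of_int (n e) + 1) \<in> polyfun E"
      using assms(1) by (intro polyfun_add polyfun_const polyfun_var)
    then show ?thesis
      using that by (cases "f = e") (auto intro: polyfun_var)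
  qed
  then show ?thesis
    by (intro eventually_polynomialI[OF c(1)] polyfun_subst[OF c(2)])
qed

text \<open>Induction on the number of edges plus the degrees: of the two terms describing a unit
  step in \<open>flow_sum_shift\<close>, one has an edge less and the other a lower degree. Demand
  zero supplies the starting value.\<close>

theorem flow_sum_eventually_polynomial:
  assumes "subgraph E"
  shows "eventually_polynomial E (\<lambda>n. flow_sum E q (net E n))"
  using assms
proof (induction "card E + (\<Sum>e\<in>E. degree (q e))" arbitrary: E q rule: less_induct)
  case less
  have fin: "finite E" using less.prems by (simp add: subgraph_def)
  obtain p where p: "\<And>r. r > 0 \<Longrightarrow>
      flow_sum E q (\<lambda>_. 0) r = of_nat r powi cyclomatic E * poly p (of_nat r)"
    using flow_sum_0_polynomial[OF less.prems] by blast
  show ?case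
  proof (rule eventually_polynomial_integral[OF fin])
    show "flow_sum E q (net E n) = flow_sum E q (net E n')"
      if "\<And>e. e \<in> E \<Longrightarrow> n e = n' e" for n n'
      using net_cong[OF that] by simp
    show "\<forall>\<^sub>F r in sequentially. flow_sum E q (net E (\<lambda>_. 0)) r =
        of_nat r powi cyclomatic E * poly p (of_nat r)"
    proof -
      have "net E (\<lambda>_. 0) = (\<lambda>_. 0)" by (intro ext) (simp add: net_def)
      then show ?thesis
        by (simp only:) (rule eventually_mono[OF eventually_gt_at_top[of 0] p])
    qed
  next
    fix e assume e: "e \<in> E"
    let ?E = "E - {e}"
    let ?D = "\<lambda>n. flow_sum E (q(e := difference (q e))) (net E n)"
    let ?C = "\<lambda>n r. poly (poly_shift 1 (q e)) (of_nat r) *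
      (of_nat r * flow_sum ?E q (net E (n(e := n e + 1))) r)"
    have "card ?E + (\<Sum>f\<in>?E. degree (q f)) < card E + (\<Sum>f\<in>E. degree (q f))"
      by (intro add_less_le_mono psubset_card_mono sum_mono2 fin) (use e in auto)
    then have "eventually_polynomial ?E (\<lambda>n. flow_sum ?E q (net ?E n))"
      by (rule less.hyps) (rule subgraph_subset[OF less.prems], auto)
    then have C: "eventually_polynomial E ?C"
      by (intro eventually_polynomial_mult_poly
          eventually_polynomial_shift[OF e, of "\<lambda>n r. of_nat r * flow_sum ?E q (net E n) r"]
          eventually_polynomial_correction less.prems e)
    \<comment> \<open>A constant \<open>q e\<close> has difference 0, which makes the whole sum
      vanish; otherwise the degree drops and the induction applies.\<close>
    have D: "eventually_polynomial E ?D"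
    proof (cases "degree (q e) = 0")
      case True
      have "flow_sum E (q(e := difference (q e))) b r = 0" for b r
        using fin e True unfolding flow_sum_def
        by (intro sum.neutral ballI) (auto simp: difference_eq_0 intro: prod_zero)
      then show ?thesis
        by (intro eventually_polynomialI[of _ _ "\<lambda>_. 0"]) (auto intro: polyfun_const)
    next
      case False
      have "(\<Sum>f\<in>E. degree ((q(e := difference (q e))) f)) < (\<Sum>f\<in>E. degree (q f))"
        by (rule sum_strict_mono_ex1[OF fin])
          (use degree_difference_less[of "q e"] False e in \<open>auto intro!: bexI[of _ e]\<close>)
      then show ?thesis by (intro less.hyps less.prems) simp
    qed
    have diff: "flow_sum E q (net E (n(e := n e + 1))) r - flow_sum E q (net E n) r = ?D n r - ?C n r"
      if "r > 0" for n r
      using flow_sum_shift[OF fin e that, of q "net E n"]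
      unfolding net_increment[OF fin e] by (simp add: mult_ac)
    from eventually_polynomial_diff[OF D C] obtain c where
      c: "\<And>n. \<forall>\<^sub>F r in sequentially. ?D n r - ?C n r =
        of_nat r powi cyclomatic E * poly (c n) (of_nat r)"
      "(\<lambda>n. coeff (c n) 0) \<in> polyfun E" by (rule eventually_polynomialE) blast
    have "\<forall>\<^sub>F r in sequentially. flow_sum E q (net E (n(e := n e + 1))) r -
        flow_sum E q (net E n) r = of_nat r powi cyclomatic E * poly (c n) (of_nat r)" for n
      using c(1)[of n] eventually_gt_at_top[of 0] by eventually_elim (simp only: diff)
    then show "eventually_polynomial E (\<lambda>n r. flow_sum E q (net E (n(e := n e + 1))) r -
        flow_sum E q (net E n) r)"
      by (rule eventually_polynomialI[OF _ c(2)])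
  qed
qed

end

section \<open>Weights with factors \<open>r - x e\<close>\<close>

context multigraph
begin

text \<open>If one half-edge of an edge carries a nonzero value \<open>x\<close>, its partner
  carries \<open>r - x\<close>, whence these weights. A factor \<open>r - x e\<close> is removed by
  expansion: \<open>r\<close> multiplies the sum as a polynomial coefficient, and \<open>x e\<close>
  is absorbed into \<open>q e\<close>.\<close>

lemma weighted_flow_sum_eventually_polynomial:
  assumes E: "subgraph E" and "finite J" and "J \<subseteq> E"
  shows "eventually_polynomial E (\<lambda>n r. \<Sum>x\<in>flows E (net E n) r.
    (\<Prod>e\<in>E. poly (q e) (of_int (x e))) * (\<Prod>e\<in>J. (of_nat r - of_int (x e)) ^ \<beta> e))"
  using assms(2,3)
proof (induction J arbitrary: q rule: finite_induct)
  case empty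
  then show ?case
    using flow_sum_eventually_polynomial[OF E, of q] by (simp add: flow_sum_def[abs_def])
next
  case (insert e J)
  have fin: "finite E" "e \<in> E" using E insert.prems by (auto simp: subgraph_def)
  have "eventually_polynomial E (\<lambda>n r. \<Sum>x\<in>flows E (net E n) r.
      (\<Prod>e\<in>E. poly (q e) (of_int (x e))) * (\<Prod>e\<in>J. (of_nat r - of_int (x e)) ^ \<beta> e) *
      (of_nat r - of_int (x e)) ^ k)" for k
  proof (induction k arbitrary: q)
    case 0
    then show ?case using insert.IH[of q] insert.prems by simp
  next
    case (Suc k)
    let ?q = "q(e := [:0, 1:] * q e)"
    have q: "(\<Prod>f\<in>E. poly (?q f) (of_int (x f))) =
        of_int (x e) * (\<Prod>f\<in>E. poly (q f) (of_int (x f)))" for x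
      by (simp add: prod.remove[OF fin])
    from eventually_polynomial_diff[OF
        eventually_polynomial_mult_poly[OF Suc.IH[of q], of "[:0, 1:]"] Suc.IH[of ?q]]
    show ?case
      unfolding q by (simp add: sum_distrib_left sum_subtractf[symmetric] algebra_simps)
  qed
  from this[of "\<beta> e"] show ?case
    using insert.hyps by (simp add: mult_ac)
qed

corollary monomial_flow_sum_eventually_polynomial:
  assumes "subgraph E"
  shows "eventually_polynomial E (\<lambda>n r. \<Sum>x\<in>flows E (net E n) r.
    \<Prod>e\<in>E. of_int (x e) ^ \<alpha> e * (of_nat r - of_int (x e)) ^ \<beta> e)"
  using weighted_flow_sum_eventually_polynomial[OF assms, of E "\<lambda>e. monom 1 (\<alpha> e)" \<beta>] assms
  by (simp add: subgraph_def poly_monom prod.distrib)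

end

section \<open>Weightings as flows\<close>

locale connected_leg_graph =
  fixes \<Gamma> :: "('v, 'h) leg_graph"
  assumes finite_verts: "finite (verts \<Gamma>)" and finite_halfedges: "finite (halfedges \<Gamma>)"
    and root_in: "h \<in> halfedges \<Gamma> \<Longrightarrow> root \<Gamma> h \<in> verts \<Gamma>"
    and invol_in: "h \<in> halfedges \<Gamma> \<Longrightarrow> invol \<Gamma> h \<in> halfedges \<Gamma>"
    and invol_invol: "h \<in> halfedges \<Gamma> \<Longrightarrow> invol \<Gamma> (invol \<Gamma> h) = h"
    and distinct_legs: "distinct (legs \<Gamma>)"
    and set_legs: "set (legs \<Gamma>) = {h \<in> halfedges \<Gamma>. invol \<Gamma> h = h}"
    and connected: "connected_graph \<Gamma>"
begin

text \<open>A half-edge \<open>h\<close> serves as the directed edge from the root of its partner to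
  its own root, so that \<open>w h\<close> counts as inflow at \<open>root \<Gamma> h\<close>. The
  edge sets of interest contain one half-edge of each edge.\<close>

sublocale multigraph "verts \<Gamma>" "\<lambda>h. root \<Gamma> (invol \<Gamma> h)" "root \<Gamma>"
  by unfold_locales (rule finite_verts)

abbreviation inner :: "'h set" where
  "inner \<equiv> halfedges \<Gamma> - set (legs \<Gamma>)"

lemma invol_inner: "h \<in> inner \<Longrightarrow> invol \<Gamma> h \<in> inner"
  using invol_in invol_invol set_legs by auto

lemma invol_neq: "h \<in> inner \<Longrightarrow> invol \<Gamma> h \<noteq> h"
  using set_legs by auto

section \<open>Orientations of the edges\<close>

definition orientation :: "'h set \<Rightarrow> bool" where
  "orientation D \<longleftrightarrow> D \<subseteq> inner \<and> (\<forall>h\<in>inner. h \<in> D \<longleftrightarrow> invol \<Gamma> h \<notin> D)"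

text \<open>The identity \<open>w (invol \<Gamma> h) = r - w h\<close> fails for \<open>w h = 0\<close>. For a given monomial this does no harm
  if each edge is oriented such that \<open>h\<close> occurs in the monomial or \<open>invol \<Gamma> h\<close> does not; hence the
  orientation depends on the monomial.\<close>

lemma orientation_exists:
  assumes "\<And>h. h \<in> inner \<Longrightarrow> P h \<or> P (invol \<Gamma> h)"
  shows "\<exists>D. orientation D \<and> (\<forall>h\<in>D. P h)"
proof -
  \<comment> \<open>The choice depends only on the unordered pair
    \<open>{h, invol \<Gamma> h}\<close>, so both half-edges agree on which of them is
    selected.\<close>
  define c where "c e = (SOME h. h \<in> e \<and> P h)" for e
  let ?e = "\<lambda>h. {h, invol \<Gamma> h}"
  have c: "c (?e h) \<in> ?e h \<and> P (c (?e h))" if "h \<in> inner" for h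
    unfolding c_def by (rule someI_ex) (use assms[OF that] in auto)
  have e: "?e (invol \<Gamma> h) = ?e h" if "h \<in> inner" for h
    using that invol_invol by auto
  have "orientation {h \<in> inner. c (?e h) = h}"
    unfolding orientation_def
  proof (intro conjI ballI)
    fix h assume h: "h \<in> inner"
    have "c (?e h) = h \<longleftrightarrow> c (?e h) \<noteq> invol \<Gamma> h"
      using c[OF h] invol_neq[OF h] by auto
    then show "h \<in> {h \<in> inner. c (?e h) = h} \<longleftrightarrow> invol \<Gamma> h \<notin> {h \<in> inner. c (?e h) = h}"
      using h invol_inner[OF h] by (simp only: mem_Collect_eq e simp_thms)
  qed auto
  moreover have "P h" if "h \<in> inner" "c (?e h) = h" for h
    using c[OF that(1)] unfolding that(2) by blast
  ultimately show ?thesis by blast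
qed

section \<open>Values and demands prescribed by the legs\<close>

definition leg_value :: "int list \<Rightarrow> 'h \<Rightarrow> int" where
  "leg_value A h = (\<Sum>j<length (legs \<Gamma>). of_bool (legs \<Gamma> ! j = h) * A ! j)"

text \<open>Leg values count as inflow at their vertex, and the inner edges have to balance them;
  hence the sign.\<close>

definition demand :: "int list \<Rightarrow> 'v \<Rightarrow> int" where
  "demand A v = - (\<Sum>h | h \<in> set (legs \<Gamma>) \<and> root \<Gamma> h = v. leg_value A h)"

lemma leg_value_nth: "j < length (legs \<Gamma>) \<Longrightarrow> leg_value A (legs \<Gamma> ! j) = A ! j"
  unfolding leg_value_def
  by (subst sum.remove[of _ j])
    (use distinct_legs in \<open>auto simp: nth_eq_iff_index_eq intro!: sum.neutral\<close>)

lemma demand_eq: "demand A v = - (\<Sum>j<length (legs \<Gamma>). of_bool (root \<Gamma> (legs \<Gamma> ! j) = v) * A ! j)"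
proof -
  have "(\<Sum>h | h \<in> set (legs \<Gamma>) \<and> root \<Gamma> h = v. leg_value A h) =
      (\<Sum>h\<in>set (legs \<Gamma>). of_bool (root \<Gamma> h = v) * leg_value A h)"
    by (rule sum.mono_neutral_cong_left) auto
  also have "\<dots> = (\<Sum>j<length (legs \<Gamma>). of_bool (root \<Gamma> (legs \<Gamma> ! j) = v) * A ! j)"
    using sum.reindex_bij_betw[OF bij_betw_nth[OF distinct_legs refl refl],
        of "\<lambda>h. of_bool (root \<Gamma> h = v) * leg_value A h"] leg_value_nth[of _ A]
    by (simp cong: sum.cong_simp)
  finally show ?thesis by (simp add: demand_def)
qed

lemma weightings_invol:
  assumes "r > 0" "w \<in> weightings \<Gamma> A r" "h \<in> inner"
  shows "w (invol \<Gamma> h) = (- w h) mod int r"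
proof -
  have "[w h + w (invol \<Gamma> h) = 0] (mod int r)" "w (invol \<Gamma> h) \<in> {0..<int r}"
    using assms invol_in by (auto simp: weightings_def PiE_iff)
  then have "[w (invol \<Gamma> h) = - w h] (mod int r)"
    by (simp add: cong_iff_dvd_diff add.commute)
  with \<open>w (invol \<Gamma> h) \<in> _\<close> show ?thesis by (simp add: cong_def)
qed

lemma weightings_leg:
  assumes "r > 0" "w \<in> weightings \<Gamma> A r" "h \<in> set (legs \<Gamma>)"
  shows "w h = leg_value A h mod int r"
proof -
  obtain j where j: "j < length (legs \<Gamma>)" "h = legs \<Gamma> ! j"
    using assms(3) by (auto simp: in_set_conv_nth)
  have "h \<in> halfedges \<Gamma>" using assms(3) set_legs by auto
  then have "[w h = A ! j] (mod int r)" "w h \<in> {0..<int r}"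
    using assms(2) j by (auto simp: weightings_def PiE_iff)
  then show ?thesis using leg_value_nth[OF j(1), of A] j(2) by (simp add: cong_def)
qed

context
  fixes D assumes D: "orientation D"
begin

lemma orientation_inner: "h \<in> D \<Longrightarrow> h \<in> inner"
  using D by (auto simp: orientation_def)

lemma orientation_finite: "finite D"
  using D finite_halfedges by (auto simp: orientation_def intro: finite_subset)

lemma orientation_invol: "h \<in> inner \<Longrightarrow> invol \<Gamma> h \<in> D \<longleftrightarrow> h \<notin> D"
  using D by (auto simp: orientation_def)

lemma orientation_subgraph: "subgraph D"
  unfolding subgraph_def using orientation_finite orientation_inner root_in invol_in by auto

lemma inner_eq_orientation: "inner = D \<union> invol \<Gamma> ` D"
proof
  show "inner \<subseteq> D \<union> invol \<Gamma> ` D"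
  proof
    fix h assume h: "h \<in> inner"
    then have "h = invol \<Gamma> (invol \<Gamma> h)" using invol_invol by simp
    then show "h \<in> D \<union> invol \<Gamma> ` D" using orientation_invol[OF h] by auto
  qed
qed (use orientation_inner invol_inner in auto)

lemma orientation_disjoint: "D \<inter> invol \<Gamma> ` D = {}"
  using orientation_invol orientation_inner by auto

lemma inj_on_invol: "inj_on (invol \<Gamma>) D"
  using orientation_inner invol_invol by (metis DiffD1 inj_onI)

lemma card_edges: "card (edges \<Gamma>) = card D"
proof -
  have "inj_on (\<lambda>h. {h, invol \<Gamma> h}) D"
    using orientation_invol orientation_inner by (auto simp: inj_on_def doubleton_eq_iff)
  moreover have "(\<lambda>h. {h, invol \<Gamma> h}) ` D = edges \<Gamma>"
  proof
    show "(\<lambda>h. {h, invol \<Gamma> h}) ` D \<subseteq> edges \<Gamma>"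
      using orientation_inner invol_neq by (auto simp: edges_def)
    show "edges \<Gamma> \<subseteq> (\<lambda>h. {h, invol \<Gamma> h}) ` D"
    proof
      fix e assume "e \<in> edges \<Gamma>"
      then obtain h where h: "h \<in> inner" "e = {h, invol \<Gamma> h}"
        using set_legs by (auto simp: edges_def)
      then have "e = {invol \<Gamma> h, invol \<Gamma> (invol \<Gamma> h)}" using invol_invol by auto
      then show "e \<in> (\<lambda>h. {h, invol \<Gamma> h}) ` D"
        using h orientation_invol[OF h(1)] by blast
    qed
  qed
  ultimately show ?thesis using card_image by metis
qed

lemma orientation_connected: "u \<in> verts \<Gamma> \<Longrightarrow> v \<in> verts \<Gamma> \<Longrightarrow> (u, v) \<in> conn D"
proof -
  assume uv: "u \<in> verts \<Gamma>" "v \<in> verts \<Gamma>"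
  have "{(root \<Gamma> h, root \<Gamma> (invol \<Gamma> h)) | h. h \<in> halfedges \<Gamma>} \<subseteq> conn D"
  proof safe
    fix h assume h: "h \<in> halfedges \<Gamma>"
    consider "h \<in> set (legs \<Gamma>)" | "h \<in> D" | "h \<in> inner" "invol \<Gamma> h \<in> D"
      using h orientation_invol by blast
    then show "(root \<Gamma> h, root \<Gamma> (invol \<Gamma> h)) \<in> conn D"
    proof cases
      case 1
      \<comment> \<open>A leg is its own partner and gives only a reflexive pair.\<close>
      then show ?thesis using set_legs by (simp add: conn_def)
    next
      case 2
      then show ?thesis using symD[OF sym_conn] edge_in_conn by blast
    next
      case 3
      then show ?thesis using edge_in_conn[OF 3(2)] invol_invol[OF h] by simp
    qed
  qed
  then have "{(root \<Gamma> h, root \<Gamma> (invol \<Gamma> h)) | h. h \<in> halfedges \<Gamma>}\<^sup>* \<subseteq> conn D"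
    unfolding conn_def by (rule rtrancl_subset_rtrancl)
  then show ?thesis
    using connected uv unfolding connected_graph_def by blast
qed

lemma cyclomatic_orientation: "cyclomatic D = betti \<Gamma>"
proof -
  obtain v where v: "v \<in> verts \<Gamma>" using connected by (auto simp: connected_graph_def)
  have "component D u = component D v" if "u \<in> verts \<Gamma>" for u
    using orientation_connected[OF that v] by (simp only: component_eq_iff)
  then have "component D ` verts \<Gamma> = {component D v}"
    using v by blast
  then show ?thesis by (simp add: cyclomatic_def betti_def card_edges)
qed

text \<open>For each leg, \<open>M j\<close> is a unit flow from its root to a fixed vertex
  \<open>v0\<close>. The combination with weights \<open>A ! j\<close> has the right demand except
  for the total of \<open>A\<close> at \<open>v0\<close>, which is 0. As \<open>M\<close> does not
  depend on \<open>A\<close>, the flow vector is linear in \<open>A\<close>.\<close>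

lemma demand_eq_net:
  "\<exists>M. \<forall>A. length A = length (legs \<Gamma>) \<and> sum_list A = 0 \<longrightarrow>
    (\<forall>v. net D (\<lambda>h. \<Sum>j<length (legs \<Gamma>). A ! j * M j h) v = demand A v)"
proof -
  obtain v0 where v0: "v0 \<in> verts \<Gamma>" using connected by (auto simp: connected_graph_def)
  have "\<exists>m. \<forall>v. net D m v = of_bool (v0 = v) - of_bool (root \<Gamma> (legs \<Gamma> ! j) = v)"
    if "j < length (legs \<Gamma>)" for j
  proof (rule conn_imp_net[OF orientation_finite orientation_connected[OF _ v0]])
    show "root \<Gamma> (legs \<Gamma> ! j) \<in> verts \<Gamma>"
      using nth_mem[OF that] set_legs root_in by auto
  qed
  then obtain M where M: "\<And>j v. j < length (legs \<Gamma>) \<Longrightarrow>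
      net D (M j) v = of_bool (v0 = v) - of_bool (root \<Gamma> (legs \<Gamma> ! j) = v)"
    by metis
  have "net D (\<lambda>h. \<Sum>j<length (legs \<Gamma>). A ! j * M j h) v = demand A v"
    if A: "length A = length (legs \<Gamma>)" "sum_list A = 0" for A v
  proof -
    have "net D (\<lambda>h. \<Sum>j<length (legs \<Gamma>). A ! j * M j h) v =
        (\<Sum>j<length (legs \<Gamma>). A ! j * net D (M j) v)"
      unfolding net_def sum_distrib_left sum_distrib_right
      by (subst sum.swap) (simp add: mult_ac)
    also have "\<dots> = of_bool (v0 = v) * (\<Sum>j<length (legs \<Gamma>). A ! j) + demand A v"
      by (simp add: M demand_eq right_diff_distrib sum_subtractf sum_distrib_left mult_ac)
    also have "(\<Sum>j<length (legs \<Gamma>). A ! j) = 0"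
      using A by (simp add: sum_list_sum_nth atLeast0LessThan)
    finally show ?thesis by simp
  qed
  then show ?thesis by blast
qed

section \<open>Bijection between weightings and flows\<close>

lemma vertex_sum_cong:
  assumes legs: "\<And>j. j < length (legs \<Gamma>) \<Longrightarrow> [w (legs \<Gamma> ! j) = A ! j] (mod int r)"
    and inner: "\<And>h. h \<in> inner \<Longrightarrow> [w h + w (invol \<Gamma> h) = 0] (mod int r)"
  shows "[(\<Sum>h | h \<in> halfedges \<Gamma> \<and> root \<Gamma> h = v. w h) = net D w v - demand A v] (mod int r)"
proof -
  let ?f = "\<lambda>h. of_bool (root \<Gamma> h = v) * w h"
  have H: "halfedges \<Gamma> = set (legs \<Gamma>) \<union> inner" "set (legs \<Gamma>) \<inter> inner = {}" "finite inner"
    using set_legs finite_halfedges by auto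
  have "(\<Sum>h | h \<in> halfedges \<Gamma> \<and> root \<Gamma> h = v. w h) = (\<Sum>h\<in>halfedges \<Gamma>. ?f h)"
    using finite_halfedges by (intro sum.mono_neutral_cong_left) auto
  also have "\<dots> = (\<Sum>h\<in>set (legs \<Gamma>). ?f h) + (\<Sum>h\<in>inner. ?f h)"
    by (subst H(1), rule sum.union_disjoint) (use H in auto)
  also have "(\<Sum>h\<in>inner. ?f h) = (\<Sum>h\<in>D. ?f h) + (\<Sum>h\<in>D. ?f (invol \<Gamma> h))"
    unfolding inner_eq_orientation
    by (subst sum.union_disjoint) (use orientation_finite orientation_disjoint in \<open>auto simp: sum.reindex[OF inj_on_invol]\<close>)
  finally have eq: "(\<Sum>h | h \<in> halfedges \<Gamma> \<and> root \<Gamma> h = v. w h) =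
      (\<Sum>h\<in>set (legs \<Gamma>). ?f h) + ((\<Sum>h\<in>D. ?f h) + (\<Sum>h\<in>D. ?f (invol \<Gamma> h)))" .
  have "(\<Sum>h\<in>set (legs \<Gamma>). ?f h) =
      (\<Sum>j<length (legs \<Gamma>). of_bool (root \<Gamma> (legs \<Gamma> ! j) = v) * w (legs \<Gamma> ! j))"
    using sum.reindex_bij_betw[OF bij_betw_nth[OF distinct_legs refl refl], of ?f] by simp
  also have "[\<dots> = - demand A v] (mod int r)"
    unfolding demand_eq minus_minus by (intro cong_sum cong_mult cong_refl legs) auto
  finally have 1: "[(\<Sum>h\<in>set (legs \<Gamma>). ?f h) = - demand A v] (mod int r)" .
  \<comment> \<open>The partner of \<open>h\<close> carries \<open>- w h\<close> modulo
    \<open>r\<close> and sits at the source of the edge \<open>h\<close>, which accounts for the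
    negative part of \<open>net\<close>.\<close>
  have "[(\<Sum>h\<in>D. ?f (invol \<Gamma> h)) = (\<Sum>h\<in>D. of_bool (root \<Gamma> (invol \<Gamma> h) = v) * - w h)] (mod int r)"
  proof (intro cong_sum cong_mult cong_refl)
    fix h assume "h \<in> D"
    from inner[OF orientation_inner[OF this]] show "[w (invol \<Gamma> h) = - w h] (mod int r)"
      by (simp add: cong_iff_dvd_diff add.commute)
  qed
  from cong_add[OF 1 cong_add[OF cong_refl this]] have
    "[(\<Sum>h | h \<in> halfedges \<Gamma> \<and> root \<Gamma> h = v. w h) = - demand A v + ((\<Sum>h\<in>D. ?f h) +
      (\<Sum>h\<in>D. of_bool (root \<Gamma> (invol \<Gamma> h) = v) * - w h))] (mod int r)"
    unfolding eq .
  also have "- demand A v + ((\<Sum>h\<in>D. ?f h) +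
      (\<Sum>h\<in>D. of_bool (root \<Gamma> (invol \<Gamma> h) = v) * - w h)) = net D w v - demand A v"
    by (simp add: net_def incidence_def sum.distrib[symmetric] algebra_simps sum_negf)
  finally show ?thesis .
qed

text \<open>Inverse of the restriction of weightings to \<open>D\<close>: the other values are
  determined modulo \<open>r\<close>, and \<open>mod\<close> selects their representatives below
  \<open>r\<close>.\<close>

definition extend_flow :: "int list \<Rightarrow> nat \<Rightarrow> ('h \<Rightarrow> int) \<Rightarrow> 'h \<Rightarrow> int" where
  "extend_flow A r x = (\<lambda>h\<in>halfedges \<Gamma>. if h \<in> D then x h
    else if h \<in> set (legs \<Gamma>) then leg_value A h mod int r else (- x (invol \<Gamma> h)) mod int r)"

lemma restrict_weighting:
  assumes w: "w \<in> weightings \<Gamma> A r"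
  shows "restrict w D \<in> flows D (demand A) r"
proof -
  have "restrict w D \<in> D \<rightarrow>\<^sub>E {0..<int r}"
    using w orientation_inner by (auto simp: weightings_def PiE_iff)
  moreover have "[net D (restrict w D) v = demand A v] (mod int r)" if "v \<in> verts \<Gamma>" for v
  proof -
    have "net D (restrict w D) = net D w" by (rule net_cong) simp
    moreover have "[net D w v - demand A v = 0] (mod int r)"
      using cong_trans[OF cong_sym[OF vertex_sum_cong[of w A r v]]] w that
      by (auto simp: weightings_def)
    ultimately show ?thesis by (simp add: cong_iff_dvd_diff)
  qed
  ultimately show ?thesis by (simp add: flows_def)
qed

lemma extend_flow_weighting:
  assumes r: "r > 0" and x: "x \<in> flows D (demand A) r"
  shows "extend_flow A r x \<in> weightings \<Gamma> A r"
proof -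
  let ?w = "extend_flow A r x"
  have xr: "x h \<in> {0..<int r}" if "h \<in> D" for h
    using x that by (auto simp: flows_def PiE_iff)
  have w1: "?w h = x h" if "h \<in> D" for h
    using that orientation_inner by (auto simp: extend_flow_def)
  have w2: "?w h = leg_value A h mod int r" if "h \<in> set (legs \<Gamma>)" for h
    using that orientation_inner set_legs by (auto simp: extend_flow_def)
  have w3: "?w h = (- x (invol \<Gamma> h)) mod int r" if "h \<in> inner" "h \<notin> D" for h
    using that by (auto simp: extend_flow_def)
  have range: "?w \<in> halfedges \<Gamma> \<rightarrow>\<^sub>E {0..<int r}"
  proof (rule PiE_I)
    fix h assume "h \<in> halfedges \<Gamma>"
    then consider "h \<in> D" | "h \<in> set (legs \<Gamma>)" | "h \<in> inner" "h \<notin> D" by blast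
    then show "?w h \<in> {0..<int r}"
      by cases (use r xr in \<open>auto simp: w1 w2 w3\<close>)
  qed (simp add: extend_flow_def)
  have leg: "[?w (legs \<Gamma> ! j) = A ! j] (mod int r)" if "j < length (legs \<Gamma>)" for j
    using that by (simp add: w2 leg_value_nth cong_def)
  have inner: "[?w h + ?w (invol \<Gamma> h) = 0] (mod int r)" if h: "h \<in> inner" for h
  proof (cases "h \<in> D")
    case True
    then have "?w (invol \<Gamma> h) = (- x h) mod int r"
      using w3[OF invol_inner[OF h]] orientation_invol[OF h] invol_invol h by auto
    then show ?thesis using w1[OF True] by (simp add: cong_def mod_add_right_eq)
  next
    case False
    then have "?w (invol \<Gamma> h) = x (invol \<Gamma> h)"
      using w1 orientation_invol[OF h] by auto
    then show ?thesis using w3[OF h False] by (simp add: cong_def mod_add_left_eq)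
  qed
  have "[(\<Sum>h | h \<in> halfedges \<Gamma> \<and> root \<Gamma> h = v. ?w h) = 0] (mod int r)" if "v \<in> verts \<Gamma>" for v
  proof -
    have "net D ?w = net D x" by (rule net_cong) (rule w1)
    then have "[net D ?w v - demand A v = 0] (mod int r)"
      using x that by (simp add: flows_def cong_iff_dvd_diff)
    with vertex_sum_cong[OF leg inner] show ?thesis by (rule cong_trans)
  qed
  then show ?thesis using range leg inner by (simp add: weightings_def)
qed

lemma sum_weightings_eq_sum_flows:
  assumes r: "r > 0"
    and eq: "\<And>w. w \<in> weightings \<Gamma> A r \<Longrightarrow> f w = g (restrict w D)"
  shows "(\<Sum>w\<in>weightings \<Gamma> A r. f w) = (\<Sum>x\<in>flows D (demand A) r. g x)"
proof (rule sum.reindex_bij_witness[of _ "extend_flow A r" "\<lambda>w. restrict w D"])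
  fix w assume w: "w \<in> weightings \<Gamma> A r"
  show "restrict w D \<in> flows D (demand A) r" by (rule restrict_weighting[OF w])
  show "g (restrict w D) = f w" using eq[OF w] by simp
  show "extend_flow A r (restrict w D) = w"
  proof
    fix h
    consider "h \<notin> halfedges \<Gamma>" | "h \<in> D" | "h \<in> set (legs \<Gamma>)" | "h \<in> inner" "h \<notin> D" by blast
    then show "extend_flow A r (restrict w D) h = w h"
    proof cases
      case 1
      then show ?thesis using w by (auto simp: extend_flow_def weightings_def PiE_iff extensional_def)
    next
      case 2
      then show ?thesis using orientation_inner by (auto simp: extend_flow_def)
    next
      case 3
      then show ?thesis using orientation_inner set_legs weightings_leg[OF r w 3]
        by (auto simp: extend_flow_def)
    next
      case 4
      then show ?thesis
        using orientation_invol[OF 4(1)] weightings_invol[OF r w invol_inner[OF 4(1)]] invol_invol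
        by (auto simp: extend_flow_def)
    qed
  qed
next
  fix x assume x: "x \<in> flows D (demand A) r"
  show "extend_flow A r x \<in> weightings \<Gamma> A r" by (rule extend_flow_weighting[OF r x])
  show "restrict (extend_flow A r x) D = x"
  proof
    fix h
    show "restrict (extend_flow A r x) D h = x h"
      using x orientation_inner[of h]
      by (cases "h \<in> D") (auto simp: extend_flow_def flows_def PiE_iff extensional_def)
  qed
qed

section \<open>Monomials in weightings and the constant term\<close>

lemma weighting_monomial:
  assumes r: "r > 0" and w: "w \<in> weightings \<Gamma> A r"
    and m: "Poly_Mapping.keys m \<subseteq> inner"
    and good: "\<And>h. h \<in> D \<Longrightarrow> Poly_Mapping.lookup m h > 0 \<or> Poly_Mapping.lookup m (invol \<Gamma> h) = 0"
  shows "rat_of_int (\<Prod>h\<in>Poly_Mapping.keys m. w h ^ Poly_Mapping.lookup m h) =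
    (\<Prod>h\<in>D. of_int (restrict w D h) ^ Poly_Mapping.lookup m h *
      (of_nat r - of_int (restrict w D h)) ^ Poly_Mapping.lookup m (invol \<Gamma> h))"
proof -
  let ?m = "Poly_Mapping.lookup m"
  have "(\<Prod>h\<in>Poly_Mapping.keys m. w h ^ ?m h) = (\<Prod>h\<in>inner. w h ^ ?m h)"
    using m finite_halfedges by (intro prod.mono_neutral_left) (auto simp: in_keys_iff)
  also have "\<dots> = (\<Prod>h\<in>D. w h ^ ?m h) * (\<Prod>h\<in>D. w (invol \<Gamma> h) ^ ?m (invol \<Gamma> h))"
    unfolding inner_eq_orientation
    by (subst prod.union_disjoint)
      (use orientation_finite orientation_disjoint in \<open>auto simp: prod.reindex[OF inj_on_invol]\<close>)
  also have "\<dots> = (\<Prod>h\<in>D. w h ^ ?m h * (int r - w h) ^ ?m (invol \<Gamma> h))"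
    unfolding prod.distrib[symmetric]
  proof (intro prod.cong refl)
    fix h assume h: "h \<in> D"
    then have wh: "w h \<in> {0..<int r}"
      using w orientation_inner by (auto simp: weightings_def PiE_iff)
    have wi: "w (invol \<Gamma> h) = (- w h) mod int r"
      by (rule weightings_invol[OF r w orientation_inner[OF h]])
    show "w h ^ ?m h * w (invol \<Gamma> h) ^ ?m (invol \<Gamma> h) =
        w h ^ ?m h * (int r - w h) ^ ?m (invol \<Gamma> h)"
    proof (cases "w h = 0")
      \<comment> \<open>Both sides vanish if \<open>h\<close> occurs in the monomial; otherwise its
        partner does not occur either, and all powers are 1.\<close>
      case True
      then show ?thesis using good[OF h] by auto
    next
      case False
      then have "(- w h) mod int r = int r - w h"
        using wh by (auto simp: zmod_zminus1_eq_if)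
      then show ?thesis by (simp add: wi)
    qed
  qed
  finally have "rat_of_int (\<Prod>h\<in>Poly_Mapping.keys m. w h ^ ?m h) =
      (\<Prod>h\<in>D. of_int (w h) ^ ?m h * (of_nat r - of_int (w h)) ^ ?m (invol \<Gamma> h))"
    by simp
  also have "\<dots> = (\<Prod>h\<in>D. of_int (restrict w D h) ^ ?m h *
      (of_nat r - of_int (restrict w D h)) ^ ?m (invol \<Gamma> h))"
    by (intro prod.cong refl) simp
  finally show ?thesis .
qed

text \<open>The flow vector \<open>?N\<close> meeting the demand is linear in the entries of
  \<open>A\<close>, so substituting it into the constant term for flows gives a polynomial function
  of \<open>A\<close>.\<close>

lemma oriented_monomial_sum:
  assumes m: "Poly_Mapping.keys m \<subseteq> inner"
    and good: "\<And>h. h \<in> D \<Longrightarrow> Poly_Mapping.lookup m h > 0 \<or> Poly_Mapping.lookup m (invol \<Gamma> h) = 0"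
  shows "\<exists>G\<in>polyfun {..<length (legs \<Gamma>)}. \<forall>A. length A = length (legs \<Gamma>) \<and> sum_list A = 0 \<longrightarrow>
    (\<exists>p. coeff p 0 = G (\<lambda>j. A ! j) \<and> (\<forall>\<^sub>F r in sequentially. of_nat r powi (- betti \<Gamma>) *
      (\<Sum>w\<in>weightings \<Gamma> A r.
        rat_of_int (\<Prod>h\<in>Poly_Mapping.keys m. w h ^ Poly_Mapping.lookup m h)) = poly p (of_nat r)))"
proof -
  let ?n = "length (legs \<Gamma>)"
  let ?m = "Poly_Mapping.lookup m"
  let ?Q = "\<lambda>r x. \<Prod>h\<in>D. rat_of_int (x h) ^ ?m h * (of_nat r - of_int (x h)) ^ ?m (invol \<Gamma> h)"
  obtain M where M: "\<And>A v. length A = ?n \<Longrightarrow> sum_list A = 0 \<Longrightarrow>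
      net D (\<lambda>h. \<Sum>j<?n. A ! j * M j h) v = demand A v"
    using demand_eq_net by blast
  obtain c where c: "\<And>n. \<forall>\<^sub>F r in sequentially. (\<Sum>x\<in>flows D (net D n) r. ?Q r x) =
      of_nat r powi cyclomatic D * poly (c n) (of_nat r)"
    and c0: "(\<lambda>n. coeff (c n) 0) \<in> polyfun D"
    by (rule eventually_polynomialE[OF monomial_flow_sum_eventually_polynomial[OF orientation_subgraph,
        where \<alpha> = ?m and \<beta> = "\<lambda>h. ?m (invol \<Gamma> h)"]]) blast
  let ?N = "\<lambda>a h. \<Sum>j<?n. a j * M j h"
  have "(\<lambda>a. of_int (?N a h)) \<in> polyfun {..<?n}" for h
  proof -
    have "(\<lambda>a. \<Sum>j<?n. of_int (a j) * of_int (M j h)) \<in> polyfun {..<?n}"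
      by (intro polyfun_sum polyfun_mult polyfun_const polyfun_var)
    then show ?thesis by simp
  qed
  then have "(\<lambda>a. coeff (c (?N a)) 0) \<in> polyfun {..<?n}"
    by (rule polyfun_subst[OF c0])
  moreover have "\<forall>\<^sub>F r in sequentially. of_nat r powi (- betti \<Gamma>) *
      (\<Sum>w\<in>weightings \<Gamma> A r. rat_of_int (\<Prod>h\<in>Poly_Mapping.keys m. w h ^ ?m h)) =
      poly (c (?N (\<lambda>j. A ! j))) (of_nat r)" if A: "length A = ?n" "sum_list A = 0" for A
    using c[of "?N (\<lambda>j. A ! j)"] eventually_gt_at_top[of 0]
  proof eventually_elim
    case (elim r)
    have "net D (?N (\<lambda>j. A ! j)) = demand A"
      by (rule ext) (rule M[OF A])
    moreover have "(\<Sum>w\<in>weightings \<Gamma> A r. rat_of_int (\<Prod>h\<in>Poly_Mapping.keys m. w h ^ ?m h)) =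
        (\<Sum>x\<in>flows D (demand A) r. ?Q r x)"
      by (rule sum_weightings_eq_sum_flows[OF elim(2)])
        (rule weighting_monomial[OF elim(2) _ m good])
    ultimately have "(\<Sum>w\<in>weightings \<Gamma> A r. rat_of_int (\<Prod>h\<in>Poly_Mapping.keys m. w h ^ ?m h)) =
        of_nat r powi betti \<Gamma> * poly (c (?N (\<lambda>j. A ! j))) (of_nat r)"
      using elim(1) by (simp only: cyclomatic_orientation)
    then show ?case
      using elim(2) by (simp add: power_int_minus)
  qed
  ultimately show ?thesis
    by (intro bexI[of _ "\<lambda>a. coeff (c (?N a)) 0"]) auto
qed

end

lemma monomial_sum:
  assumes m: "Poly_Mapping.keys m \<subseteq> inner"
  shows "\<exists>G\<in>polyfun {..<length (legs \<Gamma>)}. \<forall>A. length A = length (legs \<Gamma>) \<and> sum_list A = 0 \<longrightarrow>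
    (\<exists>p. coeff p 0 = G (\<lambda>j. A ! j) \<and> (\<forall>\<^sub>F r in sequentially. of_nat r powi (- betti \<Gamma>) *
      (\<Sum>w\<in>weightings \<Gamma> A r.
        rat_of_int (\<Prod>h\<in>Poly_Mapping.keys m. w h ^ Poly_Mapping.lookup m h)) = poly p (of_nat r)))"
proof -
  let ?P = "\<lambda>h. Poly_Mapping.lookup m h > 0 \<or> Poly_Mapping.lookup m (invol \<Gamma> h) = 0"
  \<comment> \<open>If exactly one of the two half-edges occurs in the monomial, that one is
    eligible; otherwise both are.\<close>
  have "?P h \<or> ?P (invol \<Gamma> h)" if "h \<in> inner" for h
    using that invol_invol by auto
  then have "\<exists>D. orientation D \<and> (\<forall>h\<in>D. ?P h)"
    by (rule orientation_exists[of ?P])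
  then obtain D where D: "orientation D \<and> (\<forall>h\<in>D. ?P h)" ..
  show ?thesis
    by (rule oriented_monomial_sum[OF conjunct1[OF D] m]) (rule bspec[OF conjunct2[OF D]])
qed

text \<open>The monomials of \<open>Q\<close> are combined linearly. For each \<open>A\<close> the
  eventual polynomial is exhibited, which settles the existence on which the description in
  \<open>weighting_sum_0\<close> relies.\<close>

theorem weighting_sum_0_polyfun:
  assumes "mpoly_vars Q \<subseteq> inner"
  shows "\<exists>G\<in>polyfun {..<length (legs \<Gamma>)}. \<forall>A. length A = length (legs \<Gamma>) \<and> sum_list A = 0 \<longrightarrow>
    weighting_sum_0 \<Gamma> Q A = G (\<lambda>j. A ! j)"
proof -
  let ?valid = "\<lambda>A. length A = length (legs \<Gamma>) \<and> sum_list A = 0"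
  let ?K = "Poly_Mapping.keys Q"
  let ?S = "\<lambda>m A r. of_nat r powi (- betti \<Gamma>) * (\<Sum>w\<in>weightings \<Gamma> A r.
      rat_of_int (\<Prod>h\<in>Poly_Mapping.keys m. w h ^ Poly_Mapping.lookup m h))"
  have "\<forall>m\<in>?K. \<exists>G. G \<in> polyfun {..<length (legs \<Gamma>)} \<and> (\<forall>A. ?valid A \<longrightarrow>
      (\<exists>p. coeff p 0 = G (\<lambda>j. A ! j) \<and> (\<forall>\<^sub>F r in sequentially. ?S m A r = poly p (of_nat r))))"
  proof
    fix m assume "m \<in> ?K"
    then have "Poly_Mapping.keys m \<subseteq> inner"
      using assms by (auto simp: mpoly_vars_def)
    from monomial_sum[OF this] show "\<exists>G. G \<in> polyfun {..<length (legs \<Gamma>)} \<and> (\<forall>A. ?valid A \<longrightarrow>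
      (\<exists>p. coeff p 0 = G (\<lambda>j. A ! j) \<and> (\<forall>\<^sub>F r in sequentially. ?S m A r = poly p (of_nat r))))"
      unfolding Bex_def .
  qed
  from bchoice[OF this] obtain G where G': "\<forall>m\<in>?K. G m \<in> polyfun {..<length (legs \<Gamma>)} \<and>
      (\<forall>A. ?valid A \<longrightarrow> (\<exists>p. coeff p 0 = G m (\<lambda>j. A ! j) \<and>
        (\<forall>\<^sub>F r in sequentially. ?S m A r = poly p (of_nat r))))" ..
  have G: "G m \<in> polyfun {..<length (legs \<Gamma>)}" if "m \<in> ?K" for m
    using G' that by blast
  let ?c = "\<lambda>m. rat_of_int (Poly_Mapping.lookup Q m)"
  have "weighting_sum_0 \<Gamma> Q A = (\<Sum>m\<in>?K. ?c m * G m (\<lambda>j. A ! j))" if A: "?valid A" for A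
  proof -
    have "\<forall>m\<in>?K. \<exists>p. coeff p 0 = G m (\<lambda>j. A ! j) \<and>
        (\<forall>\<^sub>F r in sequentially. ?S m A r = poly p (of_nat r))"
    proof
      fix m assume "m \<in> ?K"
      from bspec[OF G' this, THEN conjunct2, THEN spec, THEN mp, OF A]
      show "\<exists>p. coeff p 0 = G m (\<lambda>j. A ! j) \<and>
        (\<forall>\<^sub>F r in sequentially. ?S m A r = poly p (of_nat r))" .
    qed
    from bchoice[OF this] obtain p where p': "\<forall>m\<in>?K. coeff (p m) 0 = G m (\<lambda>j. A ! j) \<and>
        (\<forall>\<^sub>F r in sequentially. ?S m A r = poly (p m) (of_nat r))" ..
    have p0: "coeff (p m) 0 = G m (\<lambda>j. A ! j)"
      and p: "\<forall>\<^sub>F r in sequentially. ?S m A r = poly (p m) (of_nat r)" if "m \<in> ?K" for m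
      using bspec[OF p' that] by (rule conjunct1, rule conjunct2)
    have "\<forall>\<^sub>F r in sequentially. \<forall>m\<in>?K. ?S m A r = poly (p m) (of_nat r)"
      by (intro eventually_ball_finite ballI p) simp
    then have "\<forall>\<^sub>F r in sequentially. weighting_sum \<Gamma> Q A r =
        poly (\<Sum>m\<in>?K. smult (?c m) (p m)) (of_nat r)"
    proof eventually_elim
      case (elim r)
      have "weighting_sum \<Gamma> Q A r = (\<Sum>m\<in>?K. ?c m * ?S m A r)"
        unfolding weighting_sum_def mpoly_eval_def of_int_sum of_int_mult
        by (subst sum.swap) (simp add: sum_distrib_left mult_ac)
      then show ?case using elim by (simp add: poly_sum)
    qed
    from weighting_sum_0_eqI[OF this] show ?thesis
      by (simp add: coeff_sum p0)
  qed
  moreover have "(\<lambda>a. \<Sum>m\<in>?K. ?c m * G m a) \<in> polyfun {..<length (legs \<Gamma>)}"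
    by (intro polyfun_sum polyfun_mult polyfun_const G)
  ultimately show ?thesis
    by (intro bexI[of _ "\<lambda>a. \<Sum>m\<in>?K. ?c m * G m a"]) auto
qed

end

theorem theorem4p1:
  fixes g n :: nat
    and \<Gamma> :: "('v, 'h) leg_graph"
    and Q :: "('h, int) mpoly"
  assumes "2 * int g - 2 + int n > 0"
    and "\<Gamma> \<in> stable_graphs g n"
    and "mpoly_vars Q \<subseteq> halfedges \<Gamma> - set (legs \<Gamma>)"
  shows "\<exists>P :: (nat, rat) mpoly. mpoly_vars P \<subseteq> {..<n} \<and>
    (\<forall>A :: int list. length A = n \<and> sum_list A = 0 \<longrightarrow>
       weighting_sum_0 \<Gamma> Q A = mpoly_eval P (\<lambda>j. of_int (A ! j)))"
proof -
  interpret connected_leg_graph \<Gamma>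
    using assms(2) by unfold_locales (auto simp: stable_graphs_def)
  have n: "length (legs \<Gamma>) = n"
    using assms(2) by (simp add: stable_graphs_def)
  obtain G where G: "G \<in> polyfun {..<n}"
    and G_eq: "\<And>A. length A = n \<Longrightarrow> sum_list A = 0 \<Longrightarrow> weighting_sum_0 \<Gamma> Q A = G (\<lambda>j. A ! j)"
    using weighting_sum_0_polyfun[OF assms(3)] unfolding n by blast
  obtain P :: "(nat, rat) mpoly" where "mpoly_vars P \<subseteq> {..<n}"
    and "\<And>a. G a = mpoly_eval P (\<lambda>j. of_int (a j))"
    using polyfun_imp_mpoly[OF G] by blast
  then show ?thesis using G_eq by auto
qed

end
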